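(* Let $d\ge 2$ and let $f:\mathbb{R}^d\to[0,\infty)$ be the spectral density of a real-valued, zero-mean, second-order stationary random field on $\mathbb{R}^d$. Let $$M_d:=\min_{g}\int_{\mathbb{R}^d}\big(f(\omega)-g(\|\omega\|)\big)^2\,d\omega,$$ where the minimum is taken over all (measurable) functions $g:[0,\infty)\to\mathbb{R}$. Then $$M_d=D_{1,d}-D_{2,d},$$ where $$D_{1,d}:=\int_{\mathbb{R}^d}f^2(\omega)\,d\omega,\qquad D_{2,d}:=\frac{1}{\int_{\tau}D(1,\theta)\,d\theta}\int_0^\infty\Big(\int_\tau \tilde f(r,\theta)\,D(1,\theta)\,d\theta\Big)^2 r^{d-1}\,dr .$$ In particular, for $d=2$, $$D_{2,2}=\frac{1}{2\pi}\int_0^\infty\Big(\int_{\mathbb{R}^2}f(\omega)\,J_0(r\|\omega\|)\,d\omega\Big)^2 r\,dr .$$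
   Context: The random field has covariance function $c(h)=\mathrm{Cov}[Z(s),Z(s+h)]$, and its spectral distribution is assumed to have a density $f(\omega)=\int_{\mathbb{R}^d}\exp(-\mathrm{i}\,\omega^\top h)\,c(h)\,dh$ (an absolutely convergent integral), which forms a Fourier pair with $c$, i.e. $c(h)=(2\pi)^{-d}\int_{\mathbb{R}^d}\exp(\mathrm{i}\,\omega^\top h)f(\omega)\,d\omega$. $\|\cdot\|$ is the Euclidean norm. $\tau=[0,2\pi)\times[0,\pi)^{d-2}$ is the set of angles of spherical coordinates; $\phi$ maps a point $\omega\in\mathbb{R}^d$ to its spherical coordinates $(r,\theta)$ with $r=\|\omega\|\ge 0$, $\theta\in\tau$; $\tilde f(r,\theta)=f(\phi^{-1}(r,\theta))$ is the spherical coordinate version of $f$; and $D(r,\theta)=r^{d-1}D(1,\theta)$ is the spherical volume element, i.e. $d\omega=D(r,\theta)\,dr\,d\theta$. $J_0$ is the Bessel function (of the first kind) of order $0$, $J_0(r\|x\|)=\frac{1}{2\pi}\int_0^{2\pi}\exp(\mathrm{i}\,r(\cos\theta,\sin\theta)x)\,d\theta$ for $x\in\mathbb{R}^2$. *)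

theory Defs
  imports "HOL-Probability.Probability"
begin

section \<open>Second-order stationary random fields and their spectral densities\<close>

definition cov :: "'w measure \<Rightarrow> ('w \<Rightarrow> real) \<Rightarrow> ('w \<Rightarrow> real) \<Rightarrow> real" where
  "cov M X Y =
     (LINT w|M. (X w - (LINT v|M. X v)) * (Y w - (LINT v|M. Y v)))"

definition zero_mean :: "'w measure \<Rightarrow> ('s \<Rightarrow> 'w \<Rightarrow> real) \<Rightarrow> bool" where
  "zero_mean M Z \<longleftrightarrow> (\<forall>s. (LINT w|M. Z s w) = 0)"

definition second_order_stationary ::
    "'w measure \<Rightarrow> (real ^ 'n \<Rightarrow> 'w \<Rightarrow> real) \<Rightarrow> bool" where
  "second_order_stationary M Z \<longleftrightarrow>
     (\<forall>s. Z s \<in> borel_measurable M \<and> integrable M (\<lambda>w. (Z s w)\<^sup>2)) \<and>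
     (\<forall>s t. (LINT w|M. Z s w) = (LINT w|M. Z t w)) \<and>
     (\<forall>s t h. cov M (Z s) (Z (s + h)) = cov M (Z t) (Z (t + h)))"

text \<open>For a second-order stationary field the base point \<open>0\<close> is immaterial.\<close>

definition cov_fun :: "'w measure \<Rightarrow> (real ^ 'n \<Rightarrow> 'w \<Rightarrow> real) \<Rightarrow> real ^ 'n \<Rightarrow> real" where
  "cov_fun M Z h = cov M (Z 0) (Z (0 + h))"

text \<open>The two integrability conditions express that both integrals of the Fourier pair
  converge absolutely.\<close>

definition spectral_density ::
    "'w measure \<Rightarrow> (real ^ 'n \<Rightarrow> 'w \<Rightarrow> real) \<Rightarrow> (real ^ 'n \<Rightarrow> real) \<Rightarrow> bool" where
  "spectral_density M Z f \<longleftrightarrow>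
     integrable lborel (cov_fun M Z) \<and>
     (\<forall>\<omega>. complex_of_real (f \<omega>) =
        (LINT h|lborel. exp (- \<i> * complex_of_real (\<omega> \<bullet> h)) * complex_of_real (cov_fun M Z h))) \<and>
     integrable lborel f \<and>
     (\<forall>h. complex_of_real (cov_fun M Z h) =
        complex_of_real (1 / (2 * pi) ^ CARD('n)) *
        (LINT \<omega>|lborel. exp (\<i> * complex_of_real (\<omega> \<bullet> h)) * complex_of_real (f \<omega>)))"

section \<open>Spherical coordinates\<close>

text \<open>The coordinates of \<^typ>\<open>real ^ 'n\<close> are numbered \<open>1, \<dots>, d\<close> (with \<open>d = CARD('n)\<close>) along the
  linear order of the index type. An angle vector is a function on \<open>{1..<d}\<close> (undefined
  elsewhere): \<open>\<theta> 1\<close> is the azimuth and \<open>\<theta> 2, \<dots>, \<theta> (d - 1)\<close> are the polar angles.\<close>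

definition coord_num :: "'n::{finite,linorder} \<Rightarrow> nat" where
  "coord_num i = card {j. j \<le> i}"

definition angle_measure :: "nat \<Rightarrow> (nat \<Rightarrow> real) measure" where
  "angle_measure d = (\<Pi>\<^sub>M k\<in>{1..<d}. lborel)"

definition angles :: "nat \<Rightarrow> (nat \<Rightarrow> real) set" where
  "angles d = (\<Pi>\<^sub>E k\<in>{1..<d}. if k = 1 then {0..<2 * pi} else {0..<pi})"

text \<open>The map \<open>(r, \<theta>) \<mapsto> \<omega>\<close> from spherical to Cartesian coordinates:
  \<open>\<omega>\<^sub>1 = r cos \<theta>\<^sub>1 sin \<theta>\<^sub>2 \<cdots> sin \<theta>\<^bsub>d-1\<^esub>\<close>,
  \<open>\<omega>\<^sub>2 = r sin \<theta>\<^sub>1 sin \<theta>\<^sub>2 \<cdots> sin \<theta>\<^bsub>d-1\<^esub>\<close>, and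
  \<open>\<omega>\<^sub>m = r cos \<theta>\<^bsub>m-1\<^esub> sin \<theta>\<^sub>m \<cdots> sin \<theta>\<^bsub>d-1\<^esub>\<close> for \<open>3 \<le> m \<le> d\<close>.\<close>

definition from_spherical :: "real \<Rightarrow> (nat \<Rightarrow> real) \<Rightarrow> real ^ 'n::{finite,linorder}" where
  "from_spherical r \<theta> = (\<chi> i.
     let m = coord_num i in
     if m = 1 then r * cos (\<theta> 1) * (\<Prod>k\<in>{2..<CARD('n)}. sin (\<theta> k))
     else if m = 2 then r * sin (\<theta> 1) * (\<Prod>k\<in>{2..<CARD('n)}. sin (\<theta> k))
     else r * cos (\<theta> (m - 1)) * (\<Prod>k\<in>{m..<CARD('n)}. sin (\<theta> k)))"

text \<open>The Jacobian determinant of \<^const>\<open>from_spherical\<close> in dimension \<open>d\<close>, up to sign.\<close>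

definition vol_elem :: "nat \<Rightarrow> real \<Rightarrow> (nat \<Rightarrow> real) \<Rightarrow> real" where
  "vol_elem d r \<theta> = r ^ (d - 1) * (\<Prod>k\<in>{2..<d}. sin (\<theta> k) ^ (k - 1))"

definition spherical_version ::
    "(real ^ 'n::{finite,linorder} \<Rightarrow> real) \<Rightarrow> real \<Rightarrow> (nat \<Rightarrow> real) \<Rightarrow> real" where
  "spherical_version f r \<theta> = f (from_spherical r \<theta>)"

section \<open>Bessel function of the first kind of order zero\<close>

definition bessel_J0 :: "real \<Rightarrow> real" where
  "bessel_J0 x = (\<Sum>k. (- 1) ^ k / (fact k)\<^sup>2 * (x / 2) ^ (2 * k))"

section \<open>Squared distance to the radial functions\<close>

text \<open>Nonnegative integrals with values in \<^typ>\<open>ennreal\<close> are used because \<open>g\<close> is arbitrary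
  measurable and the integral may be infinite. The values of \<open>g\<close> on negative reals are irrelevant.\<close>

definition radial_error :: "(real ^ 'n \<Rightarrow> real) \<Rightarrow> (real \<Rightarrow> real) \<Rightarrow> ennreal" where
  "radial_error f g = (\<integral>\<^sup>+\<omega>. ennreal ((f \<omega> - g (norm \<omega>))\<^sup>2) \<partial>lborel)"

definition radial_profiles :: "(real \<Rightarrow> real) set" where
  "radial_profiles = borel_measurable (restrict_space borel {0..})"

definition M_dist :: "(real ^ 'n \<Rightarrow> real) \<Rightarrow> ennreal" where
  "M_dist f = (INF g\<in>radial_profiles. radial_error f g)"

definition D1 :: "(real ^ 'n \<Rightarrow> real) \<Rightarrow> real" where
  "D1 f = (LINT \<omega>|lborel. (f \<omega>)\<^sup>2)"

definition angular_integral ::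
    "(real ^ 'n::{finite,linorder} \<Rightarrow> real) \<Rightarrow> real \<Rightarrow> real" where
  "angular_integral f r =
     (LINT \<theta>:angles CARD('n)|angle_measure CARD('n).
        spherical_version f r \<theta> * vol_elem CARD('n) 1 \<theta>)"

definition D2 :: "(real ^ 'n::{finite,linorder} \<Rightarrow> real) \<Rightarrow> real" where
  "D2 f =
     1 / (LINT \<theta>:angles CARD('n)|angle_measure CARD('n). vol_elem CARD('n) 1 \<theta>) *
     (LINT r:{0..}|lborel. (angular_integral f r)\<^sup>2 * r ^ (CARD('n) - 1))"

end

theory Submission
  imports Defs
begin

text \<open>In spherical coordinates the error of a profile \<open>g\<close> is the integral over \<open>r\<close> of
  \<open>r\<^bsup>d-1\<^esup> (F(r) - 2 g(r) A(r) + g(r)\<^sup>2 V)\<close>, where \<open>A\<close> and \<open>F\<close> are the angular integrals of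
  \<open>f\<close> and \<open>f\<^sup>2\<close> and \<open>V\<close> is the area of the unit sphere. Completing the square in \<open>g(r)\<close>
  shows that the spherical mean \<open>g = A / V\<close> is optimal, with error \<open>F - A\<^sup>2 / V\<close>.

  For \<open>d = 2\<close>, averaging the Fourier pair \<open>(f, c)\<close> over circles gives
  \<open>A(r) = 2 \<pi> H\<^sub>c(r)\<close> and \<open>C(r) = H\<^sub>f(r) / (2 \<pi>)\<close>, where \<open>C\<close> is the angular integral of \<open>c\<close> and
  \<open>H\<^sub>u(r) = \<integral> u(x) J\<^sub>0(r \<parallel>x\<parallel>) dx\<close>. Fubini's theorem gives
  \<open>\<integral> f(\<omega>) H\<^sub>c(\<parallel>\<omega>\<parallel>) d\<omega> = \<integral> c(h) H\<^sub>f(\<parallel>h\<parallel>) dh\<close>, and in polar coordinates this reads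
  \<open>\<integral> A(r)\<^sup>2 r dr = \<integral> H\<^sub>f(r)\<^sup>2 r dr\<close>.\<close>

section \<open>Spherical coordinates\<close>

text \<open>The change of variables is built from one-variable substitutions and Tonelli. It is
  first proved for nonnegative integrals, whose iterated forms may be swapped freely, and only then
  read as an identity of measures that serves Bochner integrals. Working in \<open>ennreal\<close>
  also leaves room for profiles of infinite error.

  The Fourier pair enters the projection only through a bound: as the transform of an integrable
  covariance, \<open>f\<close> satisfies |f| \<le> K with K the integral of |c|. Hence f^2 \<le> K
  |f| is integrable, \<open>D1 f\<close> is finite, and the angular integrals of f and f^2 exist for
  every radius, not just for almost every one.

  For d = 2 the unit circle has length 2 \<pi>, so both formulas for D2 carry the same constant and
  the claim is a Plancherel identity for order-zero Hankel transforms. It is reached inside L1: f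
  and c are both integrable and |J_0| \<le> 1, so every double integral converges absolutely. Both
  functions are real, so cosines replace complex exponentials. \<open>bessel_J0\<close> is a power
  series, so its representation as a circle mean has to be derived; this is the purpose of the
  trigonometric moments.\<close>

text \<open>Substitution is applied on compact intervals, where tan is smooth: it maps
  \<open>[- arctan n, arctan n]\<close> onto \<open>[- n, n]\<close>. Monotone convergence along
  this exhaustion then yields the whole line on one side and the open interval on the other.\<close>

lemma nn_integral_tan_substitution:
  fixes F :: "real \<Rightarrow> ennreal"
  assumes [measurable]: "F \<in> borel_measurable borel"
  shows "(\<integral>\<^sup>+s. F s \<partial>lborel) =
    (\<integral>\<^sup>+\<psi>. F (tan \<psi>) * ennreal (1 + (tan \<psi>)\<^sup>2) * indicator {-(pi/2)<..<pi/2} \<psi> \<partial>lborel)"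
proof -
  let ?a = "\<lambda>n::nat. arctan (real (Suc n))"
  let ?G = "\<lambda>\<psi>. F (tan \<psi>) * ennreal (1 + (tan \<psi>)\<^sup>2)"
  have tan_meas [measurable]: "tan \<in> borel_measurable (borel :: real measure)"
    unfolding tan_def by measurable
  have step: "(\<integral>\<^sup>+s. F s * indicator {- real (Suc n)..real (Suc n)} s \<partial>lborel) =
      (\<integral>\<^sup>+\<psi>. ?G \<psi> * indicator {- ?a n..?a n} \<psi> \<partial>lborel)" for n
  proof -
    have cos0: "cos x \<noteq> 0" if "x \<in> {- ?a n..?a n}" for x
      using that arctan_bounded[of "real (Suc n)"]
      by (metis atLeastAtMost_iff cos_gt_zero_pi less_eq_real_def less_le_trans le_less_trans less_irrefl neg_less_iff_less minus_divide_left)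
    have "(\<integral>\<^sup>+s. F s * indicator {tan (- ?a n)..tan (?a n)} s \<partial>lborel) =
      (\<integral>\<^sup>+\<psi>. F (tan \<psi>) * ennreal (1 + (tan \<psi>)\<^sup>2) * indicator {- ?a n..?a n} \<psi> \<partial>lborel)"
    proof (rule nn_integral_substitution_aux)
      fix x assume "x \<in> {- ?a n..?a n}"
      then have c: "cos x \<noteq> 0" by (rule cos0)
      show "(tan has_real_derivative 1 + (tan x)\<^sup>2) (at x)"
        using DERIV_tan[OF c] tan_sec[OF c] by (simp add: power_inverse)
    next
      show "continuous_on {- ?a n..?a n} (\<lambda>x. 1 + (tan x)\<^sup>2)"
        using cos0 by (intro continuous_intros) auto
    qed (auto simp del: of_nat_Suc)
    then show ?thesis by (simp add: tan_arctan del: of_nat_Suc)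
  qed
  have "(\<integral>\<^sup>+s. F s \<partial>lborel) = (\<integral>\<^sup>+s. (SUP n. F s * indicator {- real (Suc n)..real (Suc n)} s) \<partial>lborel)"
  proof (intro nn_integral_cong)
    fix s :: real
    obtain n where "\<bar>s\<bar> \<le> real (Suc n)"
      by (meson of_nat_Suc reals_Archimedean2 less_imp_le le_less_trans lessI of_nat_less_iff)
    then have n: "s \<in> {- real (Suc n)..real (Suc n)}" by auto
    show "F s = (SUP n. F s * indicator {- real (Suc n)..real (Suc n)} s)"
    proof (rule antisym)
      show "F s \<le> (SUP n. F s * indicator {- real (Suc n)..real (Suc n)} s)"
        using n by (intro SUP_upper2[of n]) auto
    qed (auto intro!: SUP_least split: split_indicator)
  qed
  also have "\<dots> = (SUP n. \<integral>\<^sup>+s. F s * indicator {- real (Suc n)..real (Suc n)} s \<partial>lborel)"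
    by (rule nn_integral_monotone_convergence_SUP)
      (auto intro!: monoI le_funI mult_left_mono split: split_indicator)
  also have "\<dots> = (SUP n. \<integral>\<^sup>+\<psi>. ?G \<psi> * indicator {- ?a n..?a n} \<psi> \<partial>lborel)"
    unfolding step ..
  also have "\<dots> = (\<integral>\<^sup>+\<psi>. (SUP n. ?G \<psi> * indicator {- ?a n..?a n} \<psi>) \<partial>lborel)"
  proof (rule nn_integral_monotone_convergence_SUP[symmetric])
    have "?a m \<le> ?a n" if "m \<le> n" for m n using that by (simp add: arctan_le_iff)
    then show "incseq (\<lambda>n \<psi>. ?G \<psi> * indicator {- ?a n..?a n} \<psi>)"
      by (intro monoI le_funI mult_left_mono) (fastforce split: split_indicator)+
  qed auto
  also have "\<dots> = (\<integral>\<^sup>+\<psi>. ?G \<psi> * indicator {-(pi/2)<..<pi/2} \<psi> \<partial>lborel)"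
  proof (intro nn_integral_cong antisym)
    fix \<psi> :: real
    show "(SUP n. ?G \<psi> * indicator {- ?a n..?a n} \<psi>) \<le> ?G \<psi> * indicator {-(pi/2)<..<pi/2} \<psi>"
    proof (intro SUP_least mult_left_mono)
      fix n
      have "\<psi> \<in> {-(pi/2)<..<pi/2}" if "\<psi> \<in> {- ?a n..?a n}"
        using that arctan_bounded[of "real (Suc n)"] by auto
      then show "indicator {- ?a n..?a n} \<psi> \<le> (indicator {-(pi/2)<..<pi/2} \<psi> :: ennreal)"
        by (auto split: split_indicator)
    qed simp
    show "?G \<psi> * indicator {-(pi/2)<..<pi/2} \<psi> \<le> (SUP n. ?G \<psi> * indicator {- ?a n..?a n} \<psi>)"
    proof (cases "\<psi> \<in> {-(pi/2)<..<pi/2}")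
      case True
      obtain n where n: "\<bar>tan \<psi>\<bar> \<le> real (Suc n)"
        by (meson of_nat_Suc reals_Archimedean2 less_imp_le le_less_trans lessI of_nat_less_iff)
      have "arctan (tan \<psi>) = \<psi>" using True by (intro arctan_tan) auto
      moreover have "arctan (- real (Suc n)) \<le> arctan (tan \<psi>)" "arctan (tan \<psi>) \<le> arctan (real (Suc n))"
        using n by (auto simp only: arctan_le_iff)
      ultimately have "\<psi> \<in> {- ?a n..?a n}" by (simp add: arctan_minus del: of_nat_Suc)
      then show ?thesis using True by (intro SUP_upper2[of n]) auto
    qed auto
  qed
  finally show ?thesis .
qed

text \<open>The substitutions \<open>z = \<rho> tan \<psi>\<close>, \<open>\<rho> = r cos \<psi>\<close> and \<open>\<psi> = \<pi>/2 - \<phi>\<close>, one variable at a time.\<close>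

lemma nn_integral_half_plane_polar:
  fixes k :: "real \<Rightarrow> real \<Rightarrow> ennreal"
  assumes [measurable]: "case_prod k \<in> borel_measurable (borel \<Otimes>\<^sub>M borel)"
  shows "(\<integral>\<^sup>+\<rho>\<in>{0..}. (\<integral>\<^sup>+z. k \<rho> z \<partial>lborel) \<partial>lborel) =
    (\<integral>\<^sup>+r\<in>{0..}. (\<integral>\<^sup>+\<phi>\<in>{0..<pi}. k (r * sin \<phi>) (r * cos \<phi>) * ennreal r \<partial>lborel) \<partial>lborel)"
proof -
  have tan_meas [measurable]: "tan \<in> borel_measurable (borel :: real measure)"
    unfolding tan_def by measurable
  have "(\<integral>\<^sup>+\<rho>\<in>{0..}. (\<integral>\<^sup>+z. k \<rho> z \<partial>lborel) \<partial>lborel) =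
      (\<integral>\<^sup>+\<rho>. (\<integral>\<^sup>+s. ennreal \<rho> * k \<rho> (\<rho> * s) * indicator {0<..} \<rho> \<partial>lborel) \<partial>lborel)"
  \<comment> \<open>The scaling \<open>z = \<rho> * s\<close> degenerates at
    \<open>\<rho> = 0\<close>; discarding this null set turns \<open>{0..}\<close> into
    \<open>{0<..}\<close>.\<close>
  proof (rule nn_integral_cong_AE, use AE_lborel_singleton[of "0::real"] in eventually_elim)
    fix \<rho> :: real assume "\<rho> \<noteq> 0"
    show "(\<integral>\<^sup>+z. k \<rho> z \<partial>lborel) * indicator {0..} \<rho> =
       (\<integral>\<^sup>+s. ennreal \<rho> * k \<rho> (\<rho> * s) * indicator {0<..} \<rho> \<partial>lborel)"
    proof (cases "\<rho> > 0")
      case True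
      then show ?thesis
        by (subst nn_integral_real_affine[where c=\<rho> and t=0]) (auto simp: nn_integral_cmult)
    qed (use \<open>\<rho> \<noteq> 0\<close> in auto)
  qed
  \<comment> \<open>With \<open>s\<close> outermost, the inner integral is a function of
    \<open>s\<close> alone, as the tangent substitution requires.\<close>
  also have "\<dots> = (\<integral>\<^sup>+s. (\<integral>\<^sup>+\<rho>. ennreal \<rho> * k \<rho> (\<rho> * s) * indicator {0<..} \<rho> \<partial>lborel) \<partial>lborel)"
    by (rule lborel_pair.Fubini') measurable
  also have "\<dots> = (\<integral>\<^sup>+\<psi>. (\<integral>\<^sup>+\<rho>. ennreal \<rho> * k \<rho> (\<rho> * tan \<psi>) * indicator {0<..} \<rho> \<partial>lborel)
      * ennreal (1 + (tan \<psi>)\<^sup>2) * indicator {-(pi/2)<..<pi/2} \<psi> \<partial>lborel)"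
    by (rule nn_integral_tan_substitution) measurable
  also have "\<dots> = (\<integral>\<^sup>+\<psi>. (\<integral>\<^sup>+r. k (r * cos \<psi>) (r * sin \<psi>) * ennreal r * indicator {0<..} r
      * indicator {-(pi/2)<..<pi/2} \<psi> \<partial>lborel) \<partial>lborel)"
  proof (intro nn_integral_cong)
    fix \<psi> :: real
    show "(\<integral>\<^sup>+\<rho>. ennreal \<rho> * k \<rho> (\<rho> * tan \<psi>) * indicator {0<..} \<rho> \<partial>lborel)
      * ennreal (1 + (tan \<psi>)\<^sup>2) * indicator {-(pi/2)<..<pi/2} \<psi> =
      (\<integral>\<^sup>+r. k (r * cos \<psi>) (r * sin \<psi>) * ennreal r * indicator {0<..} r
      * indicator {-(pi/2)<..<pi/2} \<psi> \<partial>lborel)"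
    proof (cases "\<psi> \<in> {-(pi/2)<..<pi/2}")
      case True
      then have c: "cos \<psi> > 0" by (intro cos_gt_zero_pi) auto
      have pos: "indicator {0<..} (cos \<psi> * r) = (indicator {0<..} r :: ennreal)" for r
        using c by (auto split: split_indicator simp: zero_less_mult_iff)
      \<comment> \<open>The Jacobians cancel: \<open>\<rho> = r * cos \<psi>\<close> contributes one
        cosine from \<open>d\<rho>\<close> and one from the factor \<open>\<rho>\<close>, and the
        derivative of tan is the inverse square of the cosine. Only the factor \<open>r\<close>
        survives.\<close>
      have one: "ennreal (1 + (tan \<psi>)\<^sup>2) * (ennreal (cos \<psi>) * ennreal (cos \<psi>)) = 1"
      proof -
        have "(1 + (tan \<psi>)\<^sup>2) * (cos \<psi> * cos \<psi>) = 1"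
          using c tan_sec[of \<psi>] by (simp add: power2_eq_square field_simps)
        moreover have "ennreal (1 + (tan \<psi>)\<^sup>2) * (ennreal (cos \<psi>) * ennreal (cos \<psi>)) =
            ennreal ((1 + (tan \<psi>)\<^sup>2) * (cos \<psi> * cos \<psi>))"
          using c by (simp add: ennreal_mult del: ennreal_plus)
        ultimately show ?thesis by (simp only: ennreal_1)
      qed
      have "(\<integral>\<^sup>+\<rho>. ennreal \<rho> * k \<rho> (\<rho> * tan \<psi>) * indicator {0<..} \<rho> \<partial>lborel)
        = ennreal (cos \<psi>) * (\<integral>\<^sup>+r. ennreal (cos \<psi> * r) * k (cos \<psi> * r) (cos \<psi> * r * tan \<psi>)
          * indicator {0<..} r \<partial>lborel)"
        using c by (subst nn_integral_real_affine[where c="cos \<psi>" and t=0]) (auto simp: pos)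
      also have "\<dots> = ennreal (cos \<psi>) * (\<integral>\<^sup>+r. ennreal (cos \<psi>) * (k (r * cos \<psi>) (r * sin \<psi>) * ennreal r
          * indicator {0<..} r) \<partial>lborel)"
        using c by (intro arg_cong[where f="\<lambda>x. _ * x"] nn_integral_cong)
          (auto split: split_indicator simp: ennreal_mult tan_def mult_ac)
      also have "\<dots> = (ennreal (cos \<psi>) * ennreal (cos \<psi>)) * (\<integral>\<^sup>+r. k (r * cos \<psi>) (r * sin \<psi>) * ennreal r
          * indicator {0<..} r \<partial>lborel)"
        by (subst nn_integral_cmult) (simp_all add: mult.assoc)
      finally have eq: "(\<integral>\<^sup>+\<rho>. ennreal \<rho> * k \<rho> (\<rho> * tan \<psi>) * indicator {0<..} \<rho> \<partial>lborel) =
        ennreal (cos \<psi>) * ennreal (cos \<psi>) * (\<integral>\<^sup>+r. k (r * cos \<psi>) (r * sin \<psi>) * ennreal r * indicator {0<..} r \<partial>lborel)"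
        (is "?X = ?C * ?R") .
      have "?X * ennreal (1 + (tan \<psi>)\<^sup>2) = ennreal (1 + (tan \<psi>)\<^sup>2) * ?C * ?R"
        unfolding eq by (simp only: mult_ac)
      with one True show ?thesis by (simp del: ennreal_plus)
    qed auto
  qed
  also have "\<dots> = (\<integral>\<^sup>+\<phi>. (\<integral>\<^sup>+r. k (r * sin \<phi>) (r * cos \<phi>) * ennreal r * indicator {0<..} r
      * indicator {0<..<pi} \<phi> \<partial>lborel) \<partial>lborel)"
  proof -
    have ind: "indicator {-(pi/2)<..<pi/2} (pi/2 - \<phi>) = (indicator {0<..<pi} \<phi> :: ennreal)" for \<phi>
      by (auto split: split_indicator)
    show ?thesis
      by (subst nn_integral_real_affine[where c="-1" and t="pi/2"]) (simp_all add: ind cos_diff sin_diff)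
  qed
  also have "\<dots> = (\<integral>\<^sup>+r. (\<integral>\<^sup>+\<phi>. k (r * sin \<phi>) (r * cos \<phi>) * ennreal r * indicator {0<..} r
      * indicator {0<..<pi} \<phi> \<partial>lborel) \<partial>lborel)"
    by (rule lborel_pair.Fubini') measurable
  also have "\<dots> = (\<integral>\<^sup>+r\<in>{0..}. (\<integral>\<^sup>+\<phi>\<in>{0..<pi}. k (r * sin \<phi>) (r * cos \<phi>) * ennreal r \<partial>lborel) \<partial>lborel)"
  \<comment> \<open>Returning to half-open ranges adds only the null sets \<open>r = 0\<close> and
    \<open>\<phi> = 0\<close>.\<close>
  proof (rule nn_integral_cong_AE, use AE_lborel_singleton[of "0::real"] in eventually_elim)
    fix r :: real assume "r \<noteq> 0"
    have "(\<integral>\<^sup>+\<phi>. k (r * sin \<phi>) (r * cos \<phi>) * ennreal r * indicator {0<..} r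
      * indicator {0<..<pi} \<phi> \<partial>lborel) = (\<integral>\<^sup>+\<phi>\<in>{0..<pi}. k (r * sin \<phi>) (r * cos \<phi>) * ennreal r * indicator {0..} r \<partial>lborel)"
    proof (rule nn_integral_cong_AE, use AE_lborel_singleton[of "0::real"] in eventually_elim)
      fix \<phi> :: real assume "\<phi> \<noteq> 0"
      with \<open>r \<noteq> 0\<close> show "k (r * sin \<phi>) (r * cos \<phi>) * ennreal r * indicator {0<..} r * indicator {0<..<pi} \<phi> =
         k (r * sin \<phi>) (r * cos \<phi>) * ennreal r * indicator {0..} r * indicator {0..<pi} \<phi>"
        by (auto split: split_indicator)
    qed
    also have "\<dots> = (\<integral>\<^sup>+\<phi>\<in>{0..<pi}. k (r * sin \<phi>) (r * cos \<phi>) * ennreal r \<partial>lborel) * indicator {0..} r"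
      by (auto split: split_indicator)
    finally show "(\<integral>\<^sup>+\<phi>. k (r * sin \<phi>) (r * cos \<phi>) * ennreal r * indicator {0<..} r
      * indicator {0<..<pi} \<phi> \<partial>lborel) = (\<integral>\<^sup>+\<phi>\<in>{0..<pi}. k (r * sin \<phi>) (r * cos \<phi>) * ennreal r \<partial>lborel) * indicator {0..} r" .
  qed
  finally show ?thesis .
qed

text \<open>The lower half plane is the upper one reflected through the origin, and this reflection
  adds \<pi> to the angle. The two half turns fit together to \<open>{0..<2*pi}\<close>.\<close>

lemma nn_integral_plane_polar:
  fixes k :: "real \<Rightarrow> real \<Rightarrow> ennreal"
  assumes [measurable]: "case_prod k \<in> borel_measurable (borel \<Otimes>\<^sub>M borel)"
  shows "(\<integral>\<^sup>+x. (\<integral>\<^sup>+y. k x y \<partial>lborel) \<partial>lborel) =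
    (\<integral>\<^sup>+r\<in>{0..}. (\<integral>\<^sup>+\<phi>\<in>{0..<2*pi}. k (r * cos \<phi>) (r * sin \<phi>) * ennreal r \<partial>lborel) \<partial>lborel)"
proof -
  let ?I = "\<lambda>r. \<integral>\<^sup>+\<phi>\<in>{0..<pi}. k (r * cos \<phi>) (r * sin \<phi>) * ennreal r \<partial>lborel"
  let ?J = "\<lambda>r. \<integral>\<^sup>+\<phi>\<in>{0..<pi}. k (- (r * cos \<phi>)) (- (r * sin \<phi>)) * ennreal r \<partial>lborel"
  have J: "?J r = (\<integral>\<^sup>+\<phi>\<in>{pi..<2*pi}. k (r * cos \<phi>) (r * sin \<phi>) * ennreal r \<partial>lborel)" for r
  proof -
    have ind: "indicator {pi..<2*pi} (pi + \<phi>) = (indicator {0..<pi} \<phi> :: ennreal)" for \<phi>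
      by (auto split: split_indicator)
    show ?thesis
      by (subst (2) nn_integral_real_affine[where c="1" and t="pi"]) (simp_all add: ind cos_add sin_add)
  qed
  have upper: "(\<integral>\<^sup>+y\<in>{0..}. (\<integral>\<^sup>+x. k x y \<partial>lborel) \<partial>lborel) = (\<integral>\<^sup>+r\<in>{0..}. ?I r \<partial>lborel)"
    by (rule nn_integral_half_plane_polar[of "\<lambda>y x. k x y"]) measurable
  have "(\<integral>\<^sup>+y\<in>{..0}. (\<integral>\<^sup>+x. k x y \<partial>lborel) \<partial>lborel) =
      (\<integral>\<^sup>+y\<in>{0..}. (\<integral>\<^sup>+x. k (- x) (- y) \<partial>lborel) \<partial>lborel)"
  proof -
    have ind: "indicator {..0} (- y) = (indicator {0..} y :: ennreal)" for y :: real
      by (auto split: split_indicator)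
    have "(\<integral>\<^sup>+x. k x y \<partial>lborel) = (\<integral>\<^sup>+x. k (- x) y \<partial>lborel)" for y
      by (subst nn_integral_real_affine[where c="-1" and t="0"]) simp_all
    then show ?thesis
      by (subst nn_integral_real_affine[where c="-1" and t="0"]) (simp_all add: ind)
  qed
  also have "\<dots> = (\<integral>\<^sup>+r\<in>{0..}. ?J r \<partial>lborel)"
    by (rule nn_integral_half_plane_polar[of "\<lambda>y x. k (- x) (- y)"]) measurable
  finally have lower: "(\<integral>\<^sup>+y\<in>{..0}. (\<integral>\<^sup>+x. k x y \<partial>lborel) \<partial>lborel) = (\<integral>\<^sup>+r\<in>{0..}. ?J r \<partial>lborel)" .
  have "(\<integral>\<^sup>+x. (\<integral>\<^sup>+y. k x y \<partial>lborel) \<partial>lborel) = (\<integral>\<^sup>+y. (\<integral>\<^sup>+x. k x y \<partial>lborel) \<partial>lborel)"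
    by (rule lborel_pair.Fubini') measurable
  \<comment> \<open>The axis \<open>y = 0\<close> belongs to both half planes, but it is a null
    set.\<close>
  also have "\<dots> = (\<integral>\<^sup>+y. (\<integral>\<^sup>+x. k x y \<partial>lborel) * indicator {0..} y + (\<integral>\<^sup>+x. k x y \<partial>lborel) * indicator {..0} y \<partial>lborel)"
    by (rule nn_integral_cong_AE, use AE_lborel_singleton[of "0::real"] in eventually_elim)
      (auto split: split_indicator)
  also have "\<dots> = (\<integral>\<^sup>+r\<in>{0..}. ?I r \<partial>lborel) + (\<integral>\<^sup>+r\<in>{0..}. ?J r \<partial>lborel)"
    unfolding upper[symmetric] lower[symmetric] by (rule nn_integral_add) measurable
  also have "\<dots> = (\<integral>\<^sup>+r. ?I r * indicator {0..} r + ?J r * indicator {0..} r \<partial>lborel)"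
    by (rule nn_integral_add[symmetric]) measurable
  also have "\<dots> = (\<integral>\<^sup>+r\<in>{0..}. (\<integral>\<^sup>+\<phi>\<in>{0..<2*pi}. k (r * cos \<phi>) (r * sin \<phi>) * ennreal r \<partial>lborel) \<partial>lborel)"
  proof (intro nn_integral_cong)
    fix r :: real
    have "?I r + ?J r = (\<integral>\<^sup>+\<phi>\<in>{0..<2*pi}. k (r * cos \<phi>) (r * sin \<phi>) * ennreal r \<partial>lborel)"
      unfolding J
      by (subst nn_integral_add[symmetric], measurable, intro nn_integral_cong) (auto split: split_indicator)
    then show "?I r * indicator {0..} r + ?J r * indicator {0..} r =
      (\<integral>\<^sup>+\<phi>\<in>{0..<2*pi}. k (r * cos \<phi>) (r * sin \<phi>) * ennreal r \<partial>lborel) * indicator {0..} r"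
      by (simp add: distrib_right[symmetric])
  qed
  finally show ?thesis .
qed

section \<open>Spherical coordinates on numbered coordinates, by induction on the dimension\<close>

text \<open>In \<open>from_spherical\<close> the dimension is fixed by the type, which rules out
  induction on it. Here it is a natural number; \<open>from_spherical_eq\<close> translates
  back.\<close>

definition sph_coord :: "nat \<Rightarrow> real \<Rightarrow> (nat \<Rightarrow> real) \<Rightarrow> nat \<Rightarrow> real" where
  "sph_coord d r \<theta> m =
     (if m = 1 then r * cos (\<theta> 1) * (\<Prod>k\<in>{2..<d}. sin (\<theta> k))
      else if m = 2 then r * sin (\<theta> 1) * (\<Prod>k\<in>{2..<d}. sin (\<theta> k))
      else r * cos (\<theta> (m - 1)) * (\<Prod>k\<in>{m..<d}. sin (\<theta> k)))"

text \<open>Each product of sines gains the single factor \<open>sin \<phi>\<close>, which can be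
  absorbed into the radius. Together with \<open>sph_coord_last\<close>, the old radius and the new
  coordinate are \<open>(r * sin \<phi>, r * cos \<phi>)\<close>, exactly the half-plane polar
  coordinates.\<close>

lemma sph_coord_Suc:
  assumes "2 \<le> d" "m \<in> {1..d}"
  shows "sph_coord (Suc d) r (\<theta>(d := \<phi>)) m = sph_coord d (r * sin \<phi>) \<theta> m"
proof -
  have P: "(\<Prod>k\<in>{j..<Suc d}. sin ((\<theta>(d := \<phi>)) k)) = (\<Prod>k\<in>{j..<d}. sin (\<theta> k)) * sin \<phi>" if "j \<le> d" for j
  proof -
    have "(\<Prod>k\<in>{j..<d}. sin ((\<theta>(d := \<phi>)) k)) = (\<Prod>k\<in>{j..<d}. sin (\<theta> k))"
      by (intro prod.cong) auto
    then show ?thesis using that by (subst prod.atLeastLessThan_Suc) auto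
  qed
  have "2 \<le> d" "m \<le> d" "1 \<noteq> d" "m - 1 \<noteq> d" using assms by auto
  then show ?thesis
    unfolding sph_coord_def by (simp only: P fun_upd_other) (simp add: mult_ac)
qed

lemma sph_coord_last: "2 \<le> d \<Longrightarrow> sph_coord (Suc d) r (\<theta>(d := \<phi>)) (Suc d) = r * cos \<phi>"
  by (simp add: sph_coord_def)

lemma sum_sph_coord_squares:
  "2 \<le> d \<Longrightarrow> (\<Sum>m\<in>{1..d}. (sph_coord d r \<theta> m)\<^sup>2) = r\<^sup>2"
proof (induction d arbitrary: r rule: nat_induct_at_least)
  case base
  have "{1..2::nat} = {1, 2}" by auto
  then have "(\<Sum>m\<in>{1..2}. (sph_coord 2 r \<theta> m)\<^sup>2) = r\<^sup>2 * (cos (\<theta> 1))\<^sup>2 + r\<^sup>2 * (sin (\<theta> 1))\<^sup>2"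
    by (simp add: sph_coord_def power_mult_distrib)
  also have "\<dots> = r\<^sup>2" by (simp flip: distrib_left)
  finally show ?case .
next
  case (Suc d)
  have \<theta>: "\<theta> = \<theta>(d := \<theta> d)" by simp
  have "(\<Sum>m\<in>{1..Suc d}. (sph_coord (Suc d) r \<theta> m)\<^sup>2) =
      (\<Sum>m\<in>{1..d}. (sph_coord (Suc d) r (\<theta>(d := \<theta> d)) m)\<^sup>2) + (sph_coord (Suc d) r (\<theta>(d := \<theta> d)) (Suc d))\<^sup>2"
    by simp
  also have "\<dots> = (\<Sum>m\<in>{1..d}. (sph_coord d (r * sin (\<theta> d)) \<theta> m)\<^sup>2) + (r * cos (\<theta> d))\<^sup>2"
    using Suc.hyps sph_coord_last[of d r \<theta> "\<theta> d"] sph_coord_Suc[of d _ r \<theta> "\<theta> d"]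
    by (intro arg_cong2[where f="(+)"] sum.cong) auto
  also have "\<dots> = r\<^sup>2"
    unfolding Suc.IH by (simp add: power_mult_distrib flip: distrib_left)
  finally show ?case .
qed

text \<open>The power \<open>(r * sin \<phi>) ^ (d - 1)\<close> supplies the sine power belonging to
  the new angle; the extra \<open>r\<close> is the planar Jacobian.\<close>

lemma vol_elem_Suc:
  assumes "2 \<le> d"
  shows "vol_elem (Suc d) r (\<theta>(d := \<phi>)) = vol_elem d (r * sin \<phi>) \<theta> * r"
proof -
  have "(\<Prod>k\<in>{2..<d}. sin ((\<theta>(d := \<phi>)) k) ^ (k - 1)) = (\<Prod>k\<in>{2..<d}. sin (\<theta> k) ^ (k - 1))"
    by (intro prod.cong) auto
  moreover have "r ^ d = r ^ (d - 1) * r"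
    using assms by (simp flip: power_Suc2)
  ultimately show ?thesis
    using assms by (simp add: vol_elem_def prod.atLeastLessThan_Suc power_mult_distrib)
qed

lemma vol_elem_scale: "vol_elem d r \<theta> = r ^ (d - 1) * vol_elem d 1 \<theta>"
  by (simp add: vol_elem_def)

text \<open>As \<open>2 \<le> d\<close>, the new index is not 1, so the added angle is polar and
  ranges over a half turn.\<close>

lemma angles_Suc:
  assumes "2 \<le> d" "\<theta> \<in> extensional {1..<d}"
  shows "\<theta>(d := \<phi>) \<in> angles (Suc d) \<longleftrightarrow> \<theta> \<in> angles d \<and> \<phi> \<in> {0..<pi}"
proof -
  have "{1..<Suc d} = insert d {1..<d}" using assms by auto
  then have "\<theta>(d := \<phi>) \<in> angles (Suc d) \<longleftrightarrow>
    \<theta>(d := \<phi>) \<in> (\<Pi>\<^sub>E k\<in>insert d {1..<d}. if k = 1 then {0..<2 * pi} else {0..<pi})"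
    by (simp add: angles_def)
  also have "\<dots> \<longleftrightarrow> \<theta> \<in> angles d \<and> \<phi> \<in> {0..<pi}"
    using assms unfolding angles_def PiE_iff
    by (auto simp: extensional_def)
  finally show ?thesis .
qed

text \<open>Polar angles lie in \<open>{0..<pi}\<close>, where the sine is nonnegative, so the
  Jacobian can be used there without absolute value.\<close>

lemma vol_elem_nonneg:
  assumes "\<theta> \<in> angles d" "0 \<le> r" shows "0 \<le> vol_elem d r \<theta>"
  unfolding vol_elem_def
proof (intro mult_nonneg_nonneg prod_nonneg zero_le_power assms)
  fix k assume "k \<in> {2..<d}"
  then have "\<theta> k \<in> (if k = 1 then {0..<2 * pi} else {0..<pi})"
    by (intro PiE_mem[OF assms(1)[unfolded angles_def]]) auto
  with \<open>k \<in> {2..<d}\<close> show "0 \<le> sin (\<theta> k)" by (intro sin_ge_zero) auto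
qed

lemma sets_angles [measurable]: "angles d \<in> sets (angle_measure d)"
  unfolding angles_def angle_measure_def by (intro sets_PiM_I_finite) auto

lemma measurable_angle:
  "k \<in> {1..<d} \<Longrightarrow> (\<lambda>\<theta>. \<theta> k) \<in> borel_measurable (angle_measure d)"
  unfolding angle_measure_def by measurable

lemma measurable_vol_elem [measurable (raw)]:
  assumes [measurable]: "r \<in> borel_measurable N" "t \<in> measurable N (angle_measure d)"
  shows "(\<lambda>x. vol_elem d (r x) (t x)) \<in> borel_measurable N"
proof -
  have "(\<lambda>x. t x k) \<in> borel_measurable N" if "k \<in> {2..<d}" for k
    using that by (intro measurable_compose[OF assms(2) measurable_angle]) auto
  then show ?thesis unfolding vol_elem_def by measurable
qed

lemma measurable_sph_coord:
  assumes [measurable]: "r \<in> borel_measurable N" "t \<in> measurable N (angle_measure d)"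
    and "2 \<le> d" "m \<in> {1..d}"
  shows "(\<lambda>x. sph_coord d (r x) (t x) m) \<in> borel_measurable N"
proof -
  have meas_t [measurable]: "(\<lambda>x. t x k) \<in> borel_measurable N" if "k \<in> {1..<d}" for k
    using that by (intro measurable_compose[OF assms(2) measurable_angle]) auto
  have "(\<lambda>x. \<Prod>k\<in>{j..<d}. sin (t x k)) \<in> borel_measurable N" if "1 \<le> j" for j
    using that by (intro borel_measurable_prod borel_measurable_sin) auto
  note [measurable] = this
  show ?thesis
  proof (cases "m = 1 \<or> m = 2")
    case True then show ?thesis using assms(3) unfolding sph_coord_def by auto
  next
    case False
    then have "m - 1 \<in> {1..<d}" "1 \<le> m" using assms(4) by auto
    then have "(\<lambda>x. cos (t x (m - 1))) \<in> borel_measurable N"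
        "(\<lambda>x. \<Prod>k\<in>{m..<d}. sin (t x k)) \<in> borel_measurable N"
      using measurable_compose[OF meas_t borel_measurable_cos] by measurable
    then have "(\<lambda>x. r x * cos (t x (m - 1)) * (\<Prod>k\<in>{m..<d}. sin (t x k))) \<in> borel_measurable N"
      by (intro borel_measurable_times assms)
    then show ?thesis using False unfolding sph_coord_def by simp
  qed
qed

lemma measurable_restrict_sph_coord [measurable (raw)]:
  assumes [measurable]: "r \<in> borel_measurable N" "t \<in> measurable N (angle_measure d)" and "2 \<le> d"
  shows "(\<lambda>x. restrict (sph_coord d (r x) (t x)) {1..d}) \<in> measurable N (\<Pi>\<^sub>M k\<in>{1..d}. lborel)"
  using assms by (intro measurable_restrict) (auto intro: measurable_sph_coord)

lemma (in pair_sigma_finite) set_nn_integral_swap: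
  assumes F [measurable]: "case_prod F \<in> borel_measurable (M1 \<Otimes>\<^sub>M M2)"
    and [measurable]: "A \<in> sets M1" "B \<in> sets M2"
  shows "(\<integral>\<^sup>+x\<in>A. (\<integral>\<^sup>+y\<in>B. F x y \<partial>M2) \<partial>M1) = (\<integral>\<^sup>+y\<in>B. (\<integral>\<^sup>+x\<in>A. F x y \<partial>M1) \<partial>M2)"
proof -
  have "(\<integral>\<^sup>+x\<in>A. (\<integral>\<^sup>+y\<in>B. F x y \<partial>M2) \<partial>M1) =
      (\<integral>\<^sup>+x. (\<integral>\<^sup>+y. F x y * indicator B y * indicator A x \<partial>M2) \<partial>M1)"
    by (intro nn_integral_cong nn_integral_multc[symmetric]) measurable
  also have "\<dots> = (\<integral>\<^sup>+y. (\<integral>\<^sup>+x. F x y * indicator B y * indicator A x \<partial>M1) \<partial>M2)"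
    by (rule Fubini'[symmetric]) measurable
  also have "\<dots> = (\<integral>\<^sup>+y. (\<integral>\<^sup>+x. F x y * indicator A x * indicator B y \<partial>M1) \<partial>M2)"
    by (simp add: mult_ac)
  also have "\<dots> = (\<integral>\<^sup>+y\<in>B. (\<integral>\<^sup>+x\<in>A. F x y \<partial>M1) \<partial>M2)"
    by (intro nn_integral_cong nn_integral_multc) measurable
  finally show ?thesis .
qed

lemma sigma_finite_angle_measure: "sigma_finite_measure (angle_measure d)"
proof -
  interpret finite_product_sigma_finite "\<lambda>k::nat. lborel :: real measure" "{1..<d}"
    by standard auto
  show ?thesis unfolding angle_measure_def by (rule sigma_finite_measure_axioms)
qed

text \<open>Induction on the dimension: the last coordinate and the radius of the remaining ones range
  over a half-plane, whose polar angle is the new polar angle.\<close>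

lemma nn_integral_sph_coord:
  assumes "2 \<le> d" "h \<in> borel_measurable (\<Pi>\<^sub>M k\<in>{1..d}. lborel)"
  shows "(\<integral>\<^sup>+x. h x \<partial>(\<Pi>\<^sub>M k\<in>{1..d}. lborel)) =
    (\<integral>\<^sup>+r\<in>{0..}. (\<integral>\<^sup>+\<theta>\<in>angles d. h (restrict (sph_coord d r \<theta>) {1..d}) * ennreal (vol_elem d r \<theta>) \<partial>angle_measure d) \<partial>lborel)"
  using assms
proof (induction d arbitrary: h rule: nat_induct_at_least)
  case base
  interpret product_sigma_finite "\<lambda>k::nat. lborel :: real measure" ..
  note [measurable] = base
  have I: "{1..2::nat} = insert 2 {1}" "{1..<2::nat} = {1}" by auto
  \<comment> \<open>\<open>?v x y\<close> is the point (x, y) as an extensional function on {1,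
    2}.\<close>
  let ?v = "\<lambda>x y. (\<lambda>k\<in>{1::nat}. x)(2 := y)"
  have v [measurable (raw)]: "(\<lambda>p. ?v (f p) (g p)) \<in> measurable N (\<Pi>\<^sub>M k\<in>{1..2}. lborel)"
    if [measurable]: "f \<in> borel_measurable N" "g \<in> borel_measurable N" for f g :: "_ \<Rightarrow> real" and N
    by (rule measurable_fun_upd[where J="{1}"]) (use that in \<open>auto intro!: measurable_restrict\<close>)
  have "(\<integral>\<^sup>+x. h x \<partial>(\<Pi>\<^sub>M k\<in>{1..2}. lborel)) =
     (\<integral>\<^sup>+x. (\<integral>\<^sup>+y. h (x(2 := y)) \<partial>lborel) \<partial>(\<Pi>\<^sub>M k\<in>{1}. lborel))"
    unfolding I by (rule product_nn_integral_insert) (use base I in auto)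
  also have "\<dots> = (\<integral>\<^sup>+x. (\<integral>\<^sup>+y. h (?v (x 1) y) \<partial>lborel) \<partial>(\<Pi>\<^sub>M k\<in>{1::nat}. lborel))"
  proof (rule nn_integral_cong)
    fix x :: "nat \<Rightarrow> real" assume "x \<in> space (\<Pi>\<^sub>M k\<in>{1}. lborel)"
    then have "x \<in> extensional {1}" by (auto simp: space_PiM PiE_def)
    then have "x(2 := y) = ?v (x 1) y" for y by (auto simp: fun_eq_iff extensional_def)
    then show "(\<integral>\<^sup>+y. h (x(2 := y)) \<partial>lborel) = (\<integral>\<^sup>+y. h (?v (x 1) y) \<partial>lborel)" by simp
  qed
  also have "\<dots> = (\<integral>\<^sup>+x. (\<integral>\<^sup>+y. h (?v x y) \<partial>lborel) \<partial>lborel)"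
    by (rule product_nn_integral_singleton[where f="\<lambda>x. \<integral>\<^sup>+y. h (?v x y) \<partial>lborel"]) measurable
  also have "\<dots> = (\<integral>\<^sup>+r\<in>{0..}. (\<integral>\<^sup>+\<phi>\<in>{0..<2*pi}. h (?v (r * cos \<phi>) (r * sin \<phi>)) * ennreal r \<partial>lborel) \<partial>lborel)"
    by (rule nn_integral_plane_polar) measurable
  also have "\<dots> = (\<integral>\<^sup>+r\<in>{0..}. (\<integral>\<^sup>+\<theta>\<in>angles 2. h (restrict (sph_coord 2 r \<theta>) {1..2}) * ennreal (vol_elem 2 r \<theta>) \<partial>angle_measure 2) \<partial>lborel)"
  proof (intro nn_integral_cong arg_cong2[where f="(*)"] refl)
    fix r :: real
    have "(\<integral>\<^sup>+\<theta>\<in>angles 2. h (restrict (sph_coord 2 r \<theta>) {1..2}) * ennreal (vol_elem 2 r \<theta>) \<partial>angle_measure 2) =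
      (\<integral>\<^sup>+\<theta>. h (?v (r * cos (\<theta> 1)) (r * sin (\<theta> 1))) * ennreal r * indicator {0..<2*pi} (\<theta> 1) \<partial>angle_measure 2)"
    proof (intro nn_integral_cong)
      fix \<theta> assume "\<theta> \<in> space (angle_measure 2)"
      then have "\<theta> \<in> extensional {1}" unfolding angle_measure_def I(2) by (auto simp: space_PiM PiE_def)
      then have "indicator (angles 2) \<theta> = (indicator {0..<2*pi} (\<theta> 1) :: ennreal)"
        unfolding angles_def I(2) by (auto simp: PiE_iff split: split_indicator)
      moreover have "restrict (sph_coord 2 r \<theta>) {1..2} = ?v (r * cos (\<theta> 1)) (r * sin (\<theta> 1))"
        by (auto simp: fun_eq_iff I sph_coord_def)
      moreover have "vol_elem 2 r \<theta> = r" by (simp add: vol_elem_def)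
      ultimately show "h (restrict (sph_coord 2 r \<theta>) {1..2}) * ennreal (vol_elem 2 r \<theta>) * indicator (angles 2) \<theta> =
        h (?v (r * cos (\<theta> 1)) (r * sin (\<theta> 1))) * ennreal r * indicator {0..<2*pi} (\<theta> 1)"
        by simp
    qed
    also have "\<dots> = (\<integral>\<^sup>+\<phi>\<in>{0..<2*pi}. h (?v (r * cos \<phi>) (r * sin \<phi>)) * ennreal r \<partial>lborel)"
      unfolding angle_measure_def I
      by (rule product_nn_integral_singleton[where f="\<lambda>\<phi>. h (?v (r * cos \<phi>) (r * sin \<phi>)) * ennreal r * indicator {0..<2*pi} \<phi>"])
        measurable
    finally show "(\<integral>\<^sup>+\<phi>\<in>{0..<2*pi}. h (?v (r * cos \<phi>) (r * sin \<phi>)) * ennreal r \<partial>lborel) =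
      (\<integral>\<^sup>+\<theta>\<in>angles 2. h (restrict (sph_coord 2 r \<theta>) {1..2}) * ennreal (vol_elem 2 r \<theta>) \<partial>angle_measure 2)" ..
  qed
  finally show ?case .
next
  case (Suc d)
  interpret product_sigma_finite "\<lambda>k::nat. lborel :: real measure" ..
  interpret A: sigma_finite_measure "angle_measure d" by (rule sigma_finite_angle_measure)
  interpret P: pair_sigma_finite "lborel :: real measure" "angle_measure d" ..
  note [measurable] = Suc.prems
  have d: "2 \<le> d" by fact
  have I: "{1..Suc d} = insert (Suc d) {1..d}" "{1..<Suc d} = insert d {1..<d}" using Suc.hyps by auto
  let ?sp = "\<lambda>r \<theta>. restrict (sph_coord d r \<theta>) {1..d}"
  note sp = measurable_restrict_sph_coord[OF _ _ d, measurable (raw)]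
  have upd [measurable (raw)]: "(\<lambda>p. (f p)(Suc d := g p)) \<in> measurable N (\<Pi>\<^sub>M k\<in>{1..Suc d}. lborel)"
    if "f \<in> measurable N (\<Pi>\<^sub>M k\<in>{1..d}. lborel)" "g \<in> borel_measurable N" for f g and N
    by (rule measurable_fun_upd[where J="{1..d}"]) (use that in auto)
  have "(\<integral>\<^sup>+x. h x \<partial>(\<Pi>\<^sub>M k\<in>{1..Suc d}. lborel)) =
     (\<integral>\<^sup>+x. (\<integral>\<^sup>+z. h (x(Suc d := z)) \<partial>lborel) \<partial>(\<Pi>\<^sub>M k\<in>{1..d}. lborel))"
    unfolding I by (rule product_nn_integral_insert) (use Suc.prems I in auto)
  \<comment> \<open>The induction hypothesis is applied to the function that integrates
    \<open>h\<close> over the last coordinate \<open>z\<close>; its radius is called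
    \<open>\<rho>\<close>.\<close>
  also have "\<dots> = (\<integral>\<^sup>+\<rho>\<in>{0..}. (\<integral>\<^sup>+\<theta>\<in>angles d. (\<integral>\<^sup>+z. h ((?sp \<rho> \<theta>)(Suc d := z)) \<partial>lborel) * ennreal (vol_elem d \<rho> \<theta>) \<partial>angle_measure d) \<partial>lborel)"
    by (rule Suc.IH) measurable
  \<comment> \<open>Moving the old angles outside leaves an integral over the half plane of pairs
    \<open>(\<rho>, z)\<close>.\<close>
  also have "\<dots> = (\<integral>\<^sup>+\<theta>\<in>angles d. (\<integral>\<^sup>+\<rho>\<in>{0..}. (\<integral>\<^sup>+z. h ((?sp \<rho> \<theta>)(Suc d := z)) \<partial>lborel) * ennreal (vol_elem d \<rho> \<theta>) \<partial>lborel) \<partial>angle_measure d)"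
    by (rule P.set_nn_integral_swap) measurable
  also have "\<dots> = (\<integral>\<^sup>+\<theta>\<in>angles d. (\<integral>\<^sup>+r\<in>{0..}. (\<integral>\<^sup>+\<phi>\<in>{0..<pi}. h ((?sp (r * sin \<phi>) \<theta>)(Suc d := r * cos \<phi>)) * ennreal (vol_elem d (r * sin \<phi>) \<theta>) * ennreal r \<partial>lborel) \<partial>lborel) \<partial>angle_measure d)"
  proof (rule set_nn_integral_cong[OF refl refl])
    fix \<theta> assume "\<theta> \<in> space (angle_measure d) \<inter> angles d"
    then have [measurable]: "\<theta> \<in> space (angle_measure d)" by (rule IntD1)
    have "(\<integral>\<^sup>+\<rho>\<in>{0..}. (\<integral>\<^sup>+z. h ((?sp \<rho> \<theta>)(Suc d := z)) \<partial>lborel) * ennreal (vol_elem d \<rho> \<theta>) \<partial>lborel) =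
      (\<integral>\<^sup>+\<rho>\<in>{0..}. (\<integral>\<^sup>+z. h ((?sp \<rho> \<theta>)(Suc d := z)) * ennreal (vol_elem d \<rho> \<theta>) \<partial>lborel) \<partial>lborel)"
      by (intro nn_integral_cong arg_cong2[where f="(*)"] refl nn_integral_multc[symmetric]) measurable
    also have "\<dots> = (\<integral>\<^sup>+r\<in>{0..}. (\<integral>\<^sup>+\<phi>\<in>{0..<pi}. h ((?sp (r * sin \<phi>) \<theta>)(Suc d := r * cos \<phi>)) * ennreal (vol_elem d (r * sin \<phi>) \<theta>) * ennreal r \<partial>lborel) \<partial>lborel)"
      by (rule nn_integral_half_plane_polar) measurable
    finally show "(\<integral>\<^sup>+\<rho>\<in>{0..}. (\<integral>\<^sup>+z. h ((?sp \<rho> \<theta>)(Suc d := z)) \<partial>lborel) * ennreal (vol_elem d \<rho> \<theta>) \<partial>lborel) =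
      (\<integral>\<^sup>+r\<in>{0..}. (\<integral>\<^sup>+\<phi>\<in>{0..<pi}. h ((?sp (r * sin \<phi>) \<theta>)(Suc d := r * cos \<phi>)) * ennreal (vol_elem d (r * sin \<phi>) \<theta>) * ennreal r \<partial>lborel) \<partial>lborel)" .
  qed
  also have "\<dots> = (\<integral>\<^sup>+r\<in>{0..}. (\<integral>\<^sup>+\<theta>\<in>angles d. (\<integral>\<^sup>+\<phi>\<in>{0..<pi}. h ((?sp (r * sin \<phi>) \<theta>)(Suc d := r * cos \<phi>)) * ennreal (vol_elem d (r * sin \<phi>) \<theta>) * ennreal r \<partial>lborel) \<partial>angle_measure d) \<partial>lborel)"
    by (rule P.set_nn_integral_swap[symmetric]) measurable
  also have "\<dots> = (\<integral>\<^sup>+r\<in>{0..}. (\<integral>\<^sup>+\<theta>\<in>angles (Suc d). h (restrict (sph_coord (Suc d) r \<theta>) {1..Suc d}) * ennreal (vol_elem (Suc d) r \<theta>) \<partial>angle_measure (Suc d)) \<partial>lborel)"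
  proof (rule set_nn_integral_cong[OF refl refl])
    fix r :: real assume "r \<in> space lborel \<inter> {0..}"
    then have r: "0 \<le> r" by simp
    let ?F = "\<lambda>\<theta>. h (restrict (sph_coord (Suc d) r \<theta>) {1..Suc d}) * ennreal (vol_elem (Suc d) r \<theta>) * indicator (angles (Suc d)) \<theta>"
    have F: "?F \<in> borel_measurable (angle_measure (Suc d))"
    proof -
      have [measurable]: "(\<lambda>\<theta>. h (restrict (sph_coord (Suc d) r \<theta>) {1..Suc d})) \<in> borel_measurable (angle_measure (Suc d))"
        by (rule measurable_compose[OF measurable_restrict_sph_coord Suc.prems]) (use d in auto)
      show ?thesis by measurable
    qed
    have "(\<integral>\<^sup>+\<theta>. ?F \<theta> \<partial>angle_measure (Suc d)) = (\<integral>\<^sup>+\<theta>. (\<integral>\<^sup>+\<phi>. ?F (\<theta>(d := \<phi>)) \<partial>lborel) \<partial>angle_measure d)"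
      unfolding angle_measure_def I(2)
      by (rule product_nn_integral_insert) (use F[unfolded angle_measure_def I(2)] in auto)
    also have "\<dots> = (\<integral>\<^sup>+\<theta>\<in>angles d. (\<integral>\<^sup>+\<phi>\<in>{0..<pi}. h ((?sp (r * sin \<phi>) \<theta>)(Suc d := r * cos \<phi>)) * ennreal (vol_elem d (r * sin \<phi>) \<theta>) * ennreal r \<partial>lborel) \<partial>angle_measure d)"
    proof (intro nn_integral_cong)
      fix \<theta> assume [measurable]: "\<theta> \<in> space (angle_measure d)"
      then have ext: "\<theta> \<in> extensional {1..<d}" by (auto simp: angle_measure_def space_PiM PiE_def)
      have "?F (\<theta>(d := \<phi>)) = h ((?sp (r * sin \<phi>) \<theta>)(Suc d := r * cos \<phi>)) * ennreal (vol_elem d (r * sin \<phi>) \<theta>) * ennreal r * indicator {0..<pi} \<phi> * indicator (angles d) \<theta>" for \<phi>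
      proof -
        have "restrict (sph_coord (Suc d) r (\<theta>(d := \<phi>))) {1..Suc d} = (?sp (r * sin \<phi>) \<theta>)(Suc d := r * cos \<phi>)"
        proof
          fix m show "restrict (sph_coord (Suc d) r (\<theta>(d := \<phi>))) {1..Suc d} m = ((?sp (r * sin \<phi>) \<theta>)(Suc d := r * cos \<phi>)) m"
            using d sph_coord_Suc[OF d, of m r \<theta> \<phi>] sph_coord_last[OF d, of r \<theta> \<phi>] by (cases "m \<in> {1..d}") auto
        qed
        moreover have "indicator (angles (Suc d)) (\<theta>(d := \<phi>)) = (indicator {0..<pi} \<phi> * indicator (angles d) \<theta> :: ennreal)"
          using angles_Suc[OF d ext] by (auto split: split_indicator)
        \<comment> \<open>\<open>ennreal\<close> is split only at the factor
          \<open>r \<ge> 0\<close>. The remaining Jacobian may be negative for angles outside the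
          range, where the indicators vanish.\<close>
        ultimately show ?thesis
          using r by (simp only: vol_elem_Suc[OF d] ennreal_mult'' mult.assoc)
      qed
      then show "(\<integral>\<^sup>+\<phi>. ?F (\<theta>(d := \<phi>)) \<partial>lborel) =
        (\<integral>\<^sup>+\<phi>\<in>{0..<pi}. h ((?sp (r * sin \<phi>) \<theta>)(Suc d := r * cos \<phi>)) * ennreal (vol_elem d (r * sin \<phi>) \<theta>) * ennreal r \<partial>lborel) * indicator (angles d) \<theta>"
        by (simp only:) (rule nn_integral_multc, measurable)
    qed
    finally show "(\<integral>\<^sup>+\<theta>\<in>angles d. (\<integral>\<^sup>+\<phi>\<in>{0..<pi}. h ((?sp (r * sin \<phi>) \<theta>)(Suc d := r * cos \<phi>)) * ennreal (vol_elem d (r * sin \<phi>) \<theta>) * ennreal r \<partial>lborel) \<partial>angle_measure d)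
      = (\<integral>\<^sup>+\<theta>. ?F \<theta> \<partial>angle_measure (Suc d))" ..
  qed
  finally show ?case .
qed

section \<open>Transfer to the vector type\<close>

text \<open>Counting the indices up to \<open>i\<close> is strictly increasing in \<open>i\<close>,
  hence injective; its values lie in a set of the same cardinality as the index type.\<close>

lemma bij_betw_coord_num: "bij_betw coord_num (UNIV :: 'n::{finite,linorder} set) {1..CARD('n)}"
proof -
  have less: "coord_num i < coord_num j" if "i < j" for i j :: 'n
    unfolding coord_num_def using that by (intro psubset_card_mono) (auto simp: less_le_not_le intro: order_trans)
  then have inj: "inj (coord_num :: 'n \<Rightarrow> nat)"
    by (intro injI) (metis less_irrefl linorder_neqE)
  have "coord_num i \<in> {1..CARD('n)}" for i :: 'n
  proof -
    have "card {i} \<le> coord_num i" unfolding coord_num_def by (intro card_mono) auto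
    moreover have "coord_num i \<le> CARD('n)" unfolding coord_num_def by (intro card_mono) auto
    ultimately show ?thesis by simp
  qed
  then have "range (coord_num :: 'n \<Rightarrow> nat) = {1..CARD('n)}"
    using inj by (intro card_subset_eq) (auto simp: card_image)
  with inj show ?thesis by (simp add: bij_betw_def)
qed

lemma coord_num_mem: "coord_num (i :: 'n::{finite,linorder}) \<in> {1..CARD('n)}"
  using bij_betw_coord_num[where 'n='n] by (auto simp: bij_betw_def)

lemma measurable_coord_vec [measurable]:
  "(\<lambda>x. \<chi> i. x (coord_num i)) \<in> measurable (\<Pi>\<^sub>M k\<in>{1..CARD('n)}. lborel) (borel :: (real ^ 'n::{finite,linorder}) measure)"
proof -
  have "(\<lambda>x. x (coord_num i)) \<in> borel_measurable (\<Pi>\<^sub>M k\<in>{1..CARD('n)}. lborel)" for i :: 'n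
    using measurable_component_singleton[OF coord_num_mem[of i], of "\<lambda>_. lborel"] by simp
  then show ?thesis by (subst borel_measurable_euclidean_space) (auto simp: Basis_vec_def inner_axis)
qed

text \<open>Lebesgue measure is characterized by its values on boxes. The numbered preimage of a box
  is a product of intervals, so its measure is the product of the side lengths.\<close>

lemma lborel_vec_eq_distr:
  "(lborel :: (real ^ 'n::{finite,linorder}) measure) =
    distr (\<Pi>\<^sub>M k\<in>{1..CARD('n)}. lborel) borel (\<lambda>x. \<chi> i. x (coord_num i))"
proof (rule lborel_eqI)
  interpret product_sigma_finite "\<lambda>k::nat. lborel :: real measure" ..
  fix l u :: "(real, 'n) vec" assume "\<And>b. b \<in> Basis \<Longrightarrow> l \<bullet> b \<le> u \<bullet> b"
  then have le: "l $ i \<le> u $ i" for i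
    by (metis axis_in_Basis_iff inner_axis mult.right_neutral inner_real_def real_inner_1_right Basis_real_def singletonI)
  \<comment> \<open>\<open>c\<close> turns a coordinate number back into an index, so that the sides
    of the box can be listed by number.\<close>
  define c where "c = inv_into UNIV (coord_num :: 'n \<Rightarrow> nat)"
  have c: "c (coord_num i) = i" for i
    using bij_betw_coord_num[where 'n='n] unfolding c_def by (auto simp: bij_betw_def)
  have c': "coord_num (c k) = k" if "k \<in> {1..CARD('n)}" for k
    using bij_betw_coord_num[where 'n='n] that unfolding c_def by (metis bij_betw_inv_into_right)
  have "emeasure (distr (\<Pi>\<^sub>M k\<in>{1..CARD('n)}. lborel) borel (\<lambda>x. \<chi> i::'n. x (coord_num i))) (box l u) =
    emeasure (\<Pi>\<^sub>M k\<in>{1..CARD('n)}. lborel) ((\<lambda>x. \<chi> i::'n. x (coord_num i)) -` box l u \<inter> space (\<Pi>\<^sub>M k\<in>{1..CARD('n)}. lborel))"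
    by (rule emeasure_distr[OF measurable_coord_vec]) simp
  also have "(\<lambda>x. \<chi> i::'n. x (coord_num i)) -` box l u \<inter> space (\<Pi>\<^sub>M k\<in>{1..CARD('n)}. lborel) =
    (\<Pi>\<^sub>E k\<in>{1..CARD('n)}. {l $ c k <..< u $ c k})"
    unfolding space_PiM by (auto simp: mem_box_cart PiE_iff c c') (metis c c' atLeastAtMost_iff coord_num_mem One_nat_def)+
  also have "emeasure (\<Pi>\<^sub>M k\<in>{1..CARD('n)}. lborel) \<dots> = (\<Prod>k\<in>{1..CARD('n)}. ennreal (u $ c k - l $ c k))"
    by (subst emeasure_PiM) (auto simp: le)
  also have "\<dots> = (\<Prod>i\<in>UNIV. ennreal (u $ i - l $ i))"
    by (subst prod.reindex_bij_betw[OF bij_betw_coord_num[where 'n='n], symmetric]) (simp add: c)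
  also have "\<dots> = ennreal (\<Prod>i\<in>UNIV. u $ i - l $ i)"
    by (intro prod_ennreal) (simp add: le)
  also have "(\<Prod>i\<in>UNIV. u $ i - l $ i) = (\<Prod>b\<in>Basis. (u - l) \<bullet> b)"
  proof -
    have "bij_betw (\<lambda>i. axis i 1) UNIV (Basis :: (real, 'n) vec set)"
      by (auto simp: bij_betw_def inj_on_def Basis_vec_def axis_eq_axis)
    from prod.reindex_bij_betw[OF this, of "\<lambda>b. (u - l) \<bullet> b"] show ?thesis
      by (simp add: inner_axis)
  qed
  finally show "emeasure (distr (\<Pi>\<^sub>M k\<in>{1..CARD('n)}. lborel) borel (\<lambda>x. \<chi> i::'n. x (coord_num i))) (box l u) =
     (\<Prod>b\<in>Basis. (u - l) \<bullet> b)" .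
qed simp

text \<open>\<open>restrict\<close> leaves the values at coordinate numbers alone and makes the
  function a point of the product space, the form in which \<open>nn_integral_sph_coord\<close>
  delivers it.\<close>

lemma from_spherical_eq:
  "(from_spherical r \<theta> :: real ^ 'n::{finite,linorder}) = (\<chi> i. restrict (sph_coord CARD('n) r \<theta>) {1..CARD('n)} (coord_num i))"
  by (simp only: restrict_apply coord_num_mem if_True) (simp add: from_spherical_def sph_coord_def Let_def vec_eq_iff)

lemma measurable_from_spherical [measurable (raw)]:
  assumes "r \<in> borel_measurable N" "t \<in> measurable N (angle_measure CARD('n))" "2 \<le> CARD('n)"
  shows "(\<lambda>x. from_spherical (r x) (t x) :: real ^ 'n::{finite,linorder}) \<in> borel_measurable N"
  unfolding from_spherical_eq
  by (rule measurable_compose[OF measurable_restrict_sph_coord measurable_coord_vec]) (use assms in auto)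

lemma norm_from_spherical:
  assumes "2 \<le> CARD('n)" "0 \<le> r"
  shows "norm (from_spherical r \<theta> :: real ^ 'n::{finite,linorder}) = r"
proof -
  have "(\<Sum>i\<in>UNIV. ((from_spherical r \<theta> :: (real, 'n) vec) $ i)\<^sup>2) = (\<Sum>i\<in>UNIV. (sph_coord CARD('n) r \<theta> (coord_num (i :: 'n)))\<^sup>2)"
    by (simp only: from_spherical_eq vec_lambda_beta restrict_apply coord_num_mem if_True)
  also have "\<dots> = (\<Sum>m\<in>{1..CARD('n)}. (sph_coord CARD('n) r \<theta> m)\<^sup>2)"
    by (rule sum.reindex_bij_betw[OF bij_betw_coord_num])
  also have "\<dots> = r\<^sup>2" by (rule sum_sph_coord_squares[OF assms(1)])
  finally show ?thesis using assms(2) by (simp add: norm_vec_def L2_set_def)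
qed

lemma nn_integral_spherical:
  fixes h :: "real ^ 'n::{finite,linorder} \<Rightarrow> ennreal"
  assumes "2 \<le> CARD('n)" and [measurable]: "h \<in> borel_measurable borel"
  shows "(\<integral>\<^sup>+\<omega>. h \<omega> \<partial>lborel) = (\<integral>\<^sup>+r\<in>{0..}. (\<integral>\<^sup>+\<theta>\<in>angles CARD('n).
    h (from_spherical r \<theta>) * ennreal (vol_elem CARD('n) r \<theta>) \<partial>angle_measure CARD('n)) \<partial>lborel)"
proof -
  have "(\<integral>\<^sup>+\<omega>. h \<omega> \<partial>lborel) = (\<integral>\<^sup>+x. h (\<chi> i. x (coord_num i)) \<partial>(\<Pi>\<^sub>M k\<in>{1..CARD('n)}. lborel))"
    by (subst lborel_vec_eq_distr, rule nn_integral_distr) measurable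
  also have "\<dots> = (\<integral>\<^sup>+r\<in>{0..}. (\<integral>\<^sup>+\<theta>\<in>angles CARD('n).
    h (from_spherical r \<theta>) * ennreal (vol_elem CARD('n) r \<theta>) \<partial>angle_measure CARD('n)) \<partial>lborel)"
    unfolding from_spherical_eq by (rule nn_integral_sph_coord[OF assms(1)]) measurable
  finally show ?thesis .
qed

section \<open>Angular integrals and integration in spherical coordinates\<close>

lemma vol_elem_1_bounds:
  assumes "\<theta> \<in> angles d" shows "0 \<le> vol_elem d 1 \<theta>" "vol_elem d 1 \<theta> \<le> 1"
proof -
  show "0 \<le> vol_elem d 1 \<theta>" by (rule vol_elem_nonneg[OF assms]) simp
  have "\<bar>vol_elem d 1 \<theta>\<bar> \<le> 1"
    unfolding vol_elem_def abs_mult abs_prod power_abs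
    by (auto intro!: prod_le_1 power_le_one)
  then show "vol_elem d 1 \<theta> \<le> 1" by simp
qed

lemma emeasure_angles_finite: "emeasure (angle_measure d) (angles d) < \<infinity>"
proof -
  interpret product_sigma_finite "\<lambda>k::nat. lborel :: real measure" ..
  have "emeasure (angle_measure d) (angles d) =
    (\<Prod>k\<in>{1..<d}. emeasure lborel (if k = 1 then {0..<2 * pi} else {0..<pi}))"
    unfolding angle_measure_def angles_def by (rule emeasure_PiM) auto
  also have "\<dots> < \<infinity>"
    by (simp add: ennreal_prod_eq_top less_top[symmetric])
  finally show ?thesis .
qed

text \<open>The angle set has finite measure and the Jacobian is at most 1 on it, so boundedness of
  the integrand suffices. This is how the bound on \<open>f\<close> gives integrability at each
  single radius.\<close>

lemma set_integrable_angles: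
  fixes F :: "(nat \<Rightarrow> real) \<Rightarrow> real"
  assumes [measurable]: "F \<in> borel_measurable (angle_measure d)" and "\<And>\<theta>. \<bar>F \<theta>\<bar> \<le> K"
  shows "set_integrable (angle_measure d) (angles d) (\<lambda>\<theta>. F \<theta> * vol_elem d 1 \<theta>)"
  unfolding set_integrable_def
proof (rule Bochner_Integration.integrable_bound[where f="\<lambda>\<theta>. indicator (angles d) \<theta> *\<^sub>R K"])
  show "integrable (angle_measure d) (\<lambda>\<theta>. indicator (angles d) \<theta> *\<^sub>R K)"
    using emeasure_angles_finite by (intro integrable_scaleR_left integrable_real_indicator) auto
  show "AE \<theta> in angle_measure d. norm (indicator (angles d) \<theta> *\<^sub>R (F \<theta> * vol_elem d 1 \<theta>)) \<le> norm (indicator (angles d) \<theta> *\<^sub>R K)"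
  proof (intro AE_I2)
    fix \<theta>
    have "\<bar>F \<theta>\<bar> * \<bar>vol_elem d 1 \<theta>\<bar> \<le> K * 1" if "\<theta> \<in> angles d"
      using vol_elem_1_bounds[OF that] assms(2)[of \<theta>] by (intro mult_mono) auto
    then show "norm (indicator (angles d) \<theta> *\<^sub>R (F \<theta> * vol_elem d 1 \<theta>)) \<le> norm (indicator (angles d) \<theta> *\<^sub>R K)"
      by (auto split: split_indicator simp: abs_mult intro: order_trans)
  qed
qed measurable

definition sphere_area :: "nat \<Rightarrow> real" where
  "sphere_area d = (LINT \<theta>:angles d|angle_measure d. vol_elem d 1 \<theta>)"

lemma set_integrable_vol_elem: "set_integrable (angle_measure d) (angles d) (vol_elem d 1)"
  using set_integrable_angles[of "\<lambda>_. 1" d 1] by simp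

lemma measurable_angular_integral [measurable]:
  fixes F :: "real ^ 'n::{finite,linorder} \<Rightarrow> real"
  assumes "2 \<le> CARD('n)" and [measurable]: "F \<in> borel_measurable borel"
  shows "angular_integral F \<in> borel_measurable borel"
proof -
  interpret sigma_finite_measure "angle_measure CARD('n)" by (rule sigma_finite_angle_measure)
  note [measurable (raw)] = measurable_from_spherical[OF _ _ assms(1)]
  show ?thesis unfolding angular_integral_def spherical_version_def set_lebesgue_integral_def by measurable
qed

text \<open>On indicators, \<open>nn_integral_spherical\<close> says that \<open>lborel\<close> is
  the image under \<open>from_spherical\<close> of a weighted product measure. Integrability and the
  value of the integral then pass through image, density and Fubini.\<close>

lemma spherical_integral:
  fixes F :: "real ^ 'n::{finite,linorder} \<Rightarrow> real"
  assumes d: "2 \<le> CARD('n)" and F: "integrable lborel F"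
  shows "set_integrable lborel {0..} (\<lambda>r. angular_integral F r * r ^ (CARD('n) - 1))"
    and "(LINT \<omega>|lborel. F \<omega>) = (LINT r:{0..}|lborel. angular_integral F r * r ^ (CARD('n) - 1))"
proof -
  let ?A = "angle_measure CARD('n)" and ?d = "CARD('n)"
  interpret A: sigma_finite_measure ?A by (rule sigma_finite_angle_measure)
  interpret P: pair_sigma_finite "lborel :: real measure" ?A ..
  note [measurable (raw)] = measurable_from_spherical[OF _ _ d]
  note [measurable] = borel_measurable_integrable[OF F]
  \<comment> \<open>The cut-offs to admissible radii and angles make the Jacobian a nonnegative
    density on the whole product space.\<close>
  let ?w = "\<lambda>(r, \<theta>). indicator {0..} r * indicator (angles ?d) \<theta> * vol_elem ?d r \<theta>"
  let ?D = "density (lborel \<Otimes>\<^sub>M ?A) (\<lambda>p. ennreal (?w p))"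
  let ?s = "\<lambda>(r, \<theta>). from_spherical r \<theta> :: (real, 'n) vec"
  have w_nonneg: "0 \<le> ?w p" for p
    by (auto split: prod.split split_indicator intro: vol_elem_nonneg)
  have s [measurable]: "?s \<in> borel_measurable ?D" unfolding measurable_density_eq1 by measurable
  have distr: "(lborel :: ((real, 'n) vec) measure) = distr ?D borel ?s"
  proof (rule measure_eqI)
    fix X :: "((real, 'n) vec) set" assume "X \<in> sets lborel"
    then have X [measurable]: "X \<in> sets borel" by simp
    have "emeasure lborel X = (\<integral>\<^sup>+\<omega>. indicator X \<omega> \<partial>lborel)" by simp
    also have "\<dots> = (\<integral>\<^sup>+r\<in>{0..}. (\<integral>\<^sup>+\<theta>\<in>angles ?d.
        indicator X (from_spherical r \<theta> :: (real, 'n) vec) * ennreal (vol_elem ?d r \<theta>) \<partial>?A) \<partial>lborel)"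
      by (rule nn_integral_spherical[OF d]) measurable
    also have "\<dots> = (\<integral>\<^sup>+r. (\<integral>\<^sup>+\<theta>. ennreal (?w (r, \<theta>)) * indicator X (?s (r, \<theta>)) \<partial>?A) \<partial>lborel)"
      by (subst nn_integral_multc[symmetric], measurable) (auto intro!: nn_integral_cong split: split_indicator)
    also have "\<dots> = (\<integral>\<^sup>+p. ennreal (?w p) * indicator X (?s p) \<partial>(lborel \<Otimes>\<^sub>M ?A))"
      by (rule A.nn_integral_fst) measurable
    also have "\<dots> = (\<integral>\<^sup>+\<omega>. indicator X \<omega> \<partial>distr ?D borel ?s)"
      by (subst nn_integral_distr[OF s], simp, subst nn_integral_density) measurable
    also have "\<dots> = emeasure (distr ?D borel ?s) X" by simp
    finally show "emeasure lborel X = emeasure (distr ?D borel ?s) X" .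
  qed simp
  have "integrable ?D (\<lambda>p. F (?s p))"
    using F by (subst (asm) distr) (simp add: integrable_distr_eq)
  then have G: "integrable (lborel \<Otimes>\<^sub>M ?A) (\<lambda>p. ?w p *\<^sub>R F (?s p))"
    by (subst (asm) integrable_density) (auto simp: w_nonneg)
  have "(LINT \<omega>|lborel. F \<omega>) = (LINT p|?D. F (?s p))"
    by (subst distr) (simp add: integral_distr)
  also have "\<dots> = (LINT p|(lborel \<Otimes>\<^sub>M ?A). ?w p *\<^sub>R F (?s p))"
    by (subst integral_density) (auto simp: w_nonneg)
  also have "\<dots> = (LINT r|lborel. LINT \<theta>|?A. ?w (r, \<theta>) *\<^sub>R F (?s (r, \<theta>)))"
    by (rule P.integral_fst'[OF G, symmetric])
  finally have eq: "(LINT \<omega>|lborel. F \<omega>) = (LINT r|lborel. LINT \<theta>|?A. ?w (r, \<theta>) *\<^sub>R F (?s (r, \<theta>)))" .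
  \<comment> \<open>This holds for every \<open>r\<close>: on a slice that fails to be integrable,
    both angular integrals take the default value 0.\<close>
  have inner: "(LINT \<theta>|?A. ?w (r, \<theta>) *\<^sub>R F (?s (r, \<theta>))) =
    indicator {0..} r *\<^sub>R (angular_integral F r * r ^ (?d - 1))" for r
  proof -
    have "(LINT \<theta>|?A. ?w (r, \<theta>) *\<^sub>R F (?s (r, \<theta>))) =
      (LINT \<theta>|?A. indicator (angles ?d) \<theta> *\<^sub>R (F (from_spherical r \<theta>) * vol_elem ?d 1 \<theta>) *
        (indicator {0..} r * r ^ (?d - 1)))"
      by (rule Bochner_Integration.integral_cong) (simp_all add: vol_elem_scale[of _ r])
    also have "\<dots> = angular_integral F r * (indicator {0..} r * r ^ (?d - 1))"
      unfolding angular_integral_def spherical_version_def set_lebesgue_integral_def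
      by (rule integral_mult_left_zero)
    finally show ?thesis by simp
  qed
  show "(LINT \<omega>|lborel. F \<omega>) = (LINT r:{0..}|lborel. angular_integral F r * r ^ (CARD('n) - 1))"
    using eq unfolding inner set_lebesgue_integral_def .
  show "set_integrable lborel {0..} (\<lambda>r. angular_integral F r * r ^ (CARD('n) - 1))"
    using P.integrable_fst'[OF G] unfolding inner set_integrable_def .
qed

section \<open>Projection onto the radial functions\<close>

lemma set_integrable_spherical_version:
  fixes F :: "real ^ 'n::{finite,linorder} \<Rightarrow> real"
  assumes d: "2 \<le> CARD('n)" and [measurable]: "F \<in> borel_measurable borel" and "\<And>\<omega>. \<bar>F \<omega>\<bar> \<le> K"
  shows "set_integrable (angle_measure CARD('n)) (angles CARD('n))
    (\<lambda>\<theta>. spherical_version F r \<theta> * vol_elem CARD('n) 1 \<theta>)"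
proof (rule set_integrable_angles)
  note [measurable (raw)] = measurable_from_spherical[OF _ _ d]
  show "spherical_version F r \<in> borel_measurable (angle_measure CARD('n))"
    unfolding spherical_version_def by measurable
qed (use assms(3) in \<open>simp add: spherical_version_def\<close>)

lemma angular_integral_nonneg:
  fixes F :: "real ^ 'n::{finite,linorder} \<Rightarrow> real"
  assumes "\<And>\<omega>. 0 \<le> F \<omega>"
  shows "0 \<le> angular_integral F r"
  unfolding angular_integral_def set_lebesgue_integral_def spherical_version_def
  using assms vol_elem_1_bounds(1)
  by (intro Bochner_Integration.integral_nonneg) (auto split: split_indicator)

text \<open>Positivity is obtained without evaluating the sine integrals. If the area were not
  positive, the angular integrals of the indicator of the unit ball, squeezed between 0 and the
  area, would all vanish, and the ball would have volume 0.\<close>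

lemma sphere_area_pos:
  assumes d: "2 \<le> CARD('n::{finite,linorder})"
  shows "0 < sphere_area CARD('n)"
proof (rule ccontr)
  assume neg: "\<not> 0 < sphere_area CARD('n)"
  let ?F = "indicator (ball 0 1) :: (real, 'n) vec \<Rightarrow> real"
  have int: "integrable lborel ?F"
    using emeasure_lborel_ball_finite by (intro integrable_real_indicator) auto
  have "angular_integral ?F r = 0" for r
  proof (rule antisym)
    have "angular_integral ?F r \<le> sphere_area CARD('n)"
      unfolding angular_integral_def sphere_area_def
    proof (rule set_integral_mono)
      show "set_integrable (angle_measure CARD('n)) (angles CARD('n))
          (\<lambda>\<theta>. spherical_version ?F r \<theta> * vol_elem CARD('n) 1 \<theta>)"
        by (rule set_integrable_spherical_version[OF d, where K=1]) (auto intro!: borel_measurable_indicator split: split_indicator)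
    qed (auto simp: set_integrable_vol_elem spherical_version_def vol_elem_1_bounds split: split_indicator)
    with neg show "angular_integral ?F r \<le> 0" by simp
  qed (simp add: angular_integral_nonneg)
  then have "(LINT \<omega>|lborel. ?F \<omega>) = 0"
    unfolding spherical_integral(2)[OF d int] set_lebesgue_integral_def by simp
  then have "measure lborel (ball 0 1 :: (real, 'n) vec set) = 0" by simp
  then show False using content_ball_pos[of 1 "0 :: (real, 'n) vec"] by (simp add: measure_completion)
qed

section \<open>The error of a radial profile and its minimizer\<close>

text \<open>A radial profile is constant on each sphere, so \<open>a\<close> stands for its value
  there. Boundedness of \<open>f\<close> makes the three terms of the expanded square integrable
  separately.\<close>

lemma angular_integral_square_diff:
  fixes f :: "real ^ 'n::{finite,linorder} \<Rightarrow> real"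
  assumes d: "2 \<le> CARD('n)" and f [measurable]: "f \<in> borel_measurable borel" and K: "\<And>\<omega>. \<bar>f \<omega>\<bar> \<le> K"
    and r: "0 \<le> r"
  shows "set_integrable (angle_measure CARD('n)) (angles CARD('n))
      (\<lambda>\<theta>. (f (from_spherical r \<theta>) - a)\<^sup>2 * vol_elem CARD('n) 1 \<theta>)" (is ?int)
    and "(LINT \<theta>:angles CARD('n)|angle_measure CARD('n). (f (from_spherical r \<theta>) - a)\<^sup>2 * vol_elem CARD('n) 1 \<theta>) =
      angular_integral (\<lambda>\<omega>. (f \<omega>)\<^sup>2) r - 2 * a * angular_integral f r + a\<^sup>2 * sphere_area CARD('n)" (is ?eq)
proof -
  let ?set_int = "set_integrable (angle_measure CARD('n)) (angles CARD('n))"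
  have "\<bar>(f \<omega>)\<^sup>2\<bar> \<le> K\<^sup>2" for \<omega>
    using power_mono[OF K[of \<omega>], of 2] by simp
  then have 1: "?set_int (\<lambda>\<theta>. spherical_version (\<lambda>\<omega>. (f \<omega>)\<^sup>2) r \<theta> * vol_elem CARD('n) 1 \<theta>)"
    by (intro set_integrable_spherical_version[OF d, where K="K\<^sup>2"]) auto
  have 2: "?set_int (\<lambda>\<theta>. 2 * a * (spherical_version f r \<theta> * vol_elem CARD('n) 1 \<theta>))"
    using set_integrable_spherical_version[OF d f K] by simp
  have 3: "?set_int (\<lambda>\<theta>. a\<^sup>2 * vol_elem CARD('n) 1 \<theta>)"
    using set_integrable_vol_elem by simp
  have expand: "(f (from_spherical r \<theta>) - a)\<^sup>2 * vol_elem CARD('n) 1 \<theta> =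
    spherical_version (\<lambda>\<omega>. (f \<omega>)\<^sup>2) r \<theta> * vol_elem CARD('n) 1 \<theta>
    - 2 * a * (spherical_version f r \<theta> * vol_elem CARD('n) 1 \<theta>) + a\<^sup>2 * vol_elem CARD('n) 1 \<theta>" for \<theta>
    by (simp add: spherical_version_def power2_eq_square algebra_simps)
  show ?int unfolding expand by (intro set_integral_add set_integral_diff 1 2 3)
  show ?eq
    unfolding expand angular_integral_def sphere_area_def
    by (simp only: set_integral_add(2)[OF set_integral_diff(1)[OF 1 2] 3] set_integral_diff(2)[OF 1 2]
      set_integral_mult_right)
qed

lemma nn_set_integral_eq_set_integral:
  fixes F :: "_ \<Rightarrow> real"
  assumes "set_integrable M A F" "\<And>x. x \<in> A \<Longrightarrow> 0 \<le> F x"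
  shows "(\<integral>\<^sup>+x\<in>A. ennreal (F x) \<partial>M) = ennreal (LINT x:A|M. F x)"
proof -
  have "(\<integral>\<^sup>+x\<in>A. ennreal (F x) \<partial>M) = (\<integral>\<^sup>+x. ennreal (indicator A x *\<^sub>R F x) \<partial>M)"
    by (intro nn_integral_cong) (auto split: split_indicator)
  also have "\<dots> = ennreal (LINT x:A|M. F x)"
    unfolding set_lebesgue_integral_def
    using assms by (intro nn_integral_eq_integral) (auto simp: set_integrable_def split: split_indicator)
  finally show ?thesis .
qed

lemma radial_error_eq:
  fixes f :: "real ^ 'n::{finite,linorder} \<Rightarrow> real"
  assumes d: "2 \<le> CARD('n)" and f [measurable]: "f \<in> borel_measurable borel" and K: "\<And>\<omega>. \<bar>f \<omega>\<bar> \<le> K"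
    and g: "g \<in> radial_profiles"
  shows "radial_error f g = (\<integral>\<^sup>+r\<in>{0..}. ennreal ((angular_integral (\<lambda>\<omega>. (f \<omega>)\<^sup>2) r
    - 2 * g r * angular_integral f r + (g r)\<^sup>2 * sphere_area CARD('n)) * r ^ (CARD('n) - 1)) \<partial>lborel)"
proof -
  \<comment> \<open>\<open>g\<close> is measurable on the half-line only; the norm takes its values
    there.\<close>
  have [measurable]: "(\<lambda>\<omega>::(real, 'n) vec. g (norm \<omega>)) \<in> borel_measurable borel"
    by (rule measurable_compose[OF _ g[unfolded radial_profiles_def]])
      (auto intro!: measurable_restrict_space2)
  have "radial_error f g = (\<integral>\<^sup>+r\<in>{0..}. (\<integral>\<^sup>+\<theta>\<in>angles CARD('n).
    ennreal ((f (from_spherical r \<theta>) - g (norm (from_spherical r \<theta> :: (real, 'n) vec)))\<^sup>2)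
      * ennreal (vol_elem CARD('n) r \<theta>) \<partial>angle_measure CARD('n)) \<partial>lborel)"
    unfolding radial_error_def by (rule nn_integral_spherical[OF d]) measurable
  also have "\<dots> = (\<integral>\<^sup>+r\<in>{0..}. ennreal ((angular_integral (\<lambda>\<omega>. (f \<omega>)\<^sup>2) r
    - 2 * g r * angular_integral f r + (g r)\<^sup>2 * sphere_area CARD('n)) * r ^ (CARD('n) - 1)) \<partial>lborel)"
  proof (rule set_nn_integral_cong[OF refl refl])
    fix r :: real assume "r \<in> space lborel \<inter> {0..}"
    then have r: "0 \<le> r" by simp
    note sq = angular_integral_square_diff[OF d f K r, of "g r"]
    have "(\<integral>\<^sup>+\<theta>\<in>angles CARD('n).
        ennreal ((f (from_spherical r \<theta>) - g (norm (from_spherical r \<theta> :: (real, 'n) vec)))\<^sup>2)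
        * ennreal (vol_elem CARD('n) r \<theta>) \<partial>angle_measure CARD('n)) =
      (\<integral>\<^sup>+\<theta>\<in>angles CARD('n).
        ennreal ((f (from_spherical r \<theta>) - g r)\<^sup>2 * vol_elem CARD('n) 1 \<theta> * r ^ (CARD('n) - 1))
        \<partial>angle_measure CARD('n))"
      by (intro nn_integral_cong arg_cong2[where f="(*)"] refl)
        (simp add: norm_from_spherical[OF d r] vol_elem_scale[of _ r] ennreal_mult'[symmetric] mult_ac)
    also have "\<dots> = ennreal (LINT \<theta>:angles CARD('n)|angle_measure CARD('n).
        (f (from_spherical r \<theta>) - g r)\<^sup>2 * vol_elem CARD('n) 1 \<theta> * r ^ (CARD('n) - 1))"
      using sq(1) r vol_elem_1_bounds(1) by (intro nn_set_integral_eq_set_integral) auto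
    finally show "(\<integral>\<^sup>+\<theta>\<in>angles CARD('n).
        ennreal ((f (from_spherical r \<theta>) - g (norm (from_spherical r \<theta> :: (real, 'n) vec)))\<^sup>2)
        * ennreal (vol_elem CARD('n) r \<theta>) \<partial>angle_measure CARD('n)) =
      ennreal ((angular_integral (\<lambda>\<omega>. (f \<omega>)\<^sup>2) r
        - 2 * g r * angular_integral f r + (g r)\<^sup>2 * sphere_area CARD('n)) * r ^ (CARD('n) - 1))"
      by (simp only: sq(2) set_integral_mult_left)
  qed
  finally show ?thesis .
qed

lemma radial_projection:
  fixes f :: "real ^ 'n::{finite,linorder} \<Rightarrow> real"
  assumes d: "2 \<le> CARD('n)" and f [measurable]: "f \<in> borel_measurable borel" and K: "\<And>\<omega>. \<bar>f \<omega>\<bar> \<le> K"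
    and f2: "integrable lborel (\<lambda>\<omega>. (f \<omega>)\<^sup>2)"
  shows "set_integrable lborel {0..} (\<lambda>r. (angular_integral f r)\<^sup>2 * r ^ (CARD('n) - 1))" (is ?int)
    and "\<exists>g\<in>radial_profiles. radial_error f g = M_dist f" (is ?ex)
    and "enn2ereal (M_dist f) = ereal (D1 f - D2 f)" (is ?val)
proof -
  define V where "V = sphere_area CARD('n)"
  define A where "A = angular_integral f"
  define F where "F = angular_integral (\<lambda>\<omega>. (f \<omega>)\<^sup>2)"
  have V: "0 < V" unfolding V_def by (rule sphere_area_pos[OF d])
  have A [measurable]: "A \<in> borel_measurable borel" unfolding A_def by (rule measurable_angular_integral[OF d f])
  have err: "radial_error f g = (\<integral>\<^sup>+r\<in>{0..}. ennreal ((F r - 2 * g r * A r + (g r)\<^sup>2 * V) * r ^ (CARD('n) - 1)) \<partial>lborel)"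
    if "g \<in> radial_profiles" for g
    unfolding F_def A_def V_def by (rule radial_error_eq[OF d f K that])
  have square: "F r - 2 * a * A r + a\<^sup>2 * V = (F r - (A r)\<^sup>2 / V) + V * (a - A r / V)\<^sup>2" for r a
    using V by (simp add: field_simps power2_eq_square)
  \<comment> \<open>This is the Cauchy-Schwarz inequality on the sphere, read off the nonnegative
    integral of \<open>(f - a)\<^sup>2\<close> at the vertex \<open>a = A r / V\<close>.\<close>
  have cs: "0 \<le> F r - (A r)\<^sup>2 / V" if "0 \<le> r" for r
  proof -
    have "0 \<le> F r - 2 * (A r / V) * A r + (A r / V)\<^sup>2 * V"
      unfolding F_def A_def V_def angular_integral_square_diff(2)[OF d f K that, symmetric] set_lebesgue_integral_def
      using vol_elem_1_bounds(1) by (intro Bochner_Integration.integral_nonneg) (auto split: split_indicator)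
    then show ?thesis unfolding square by simp
  qed
  note F = spherical_integral[OF d f2, folded F_def]
  \<comment> \<open>By \<open>cs\<close>, \<open>(A r)\<^sup>2\<close> is at most
    \<open>V * F r\<close>, and \<open>F\<close> has an integrable radial density because
    \<open>f\<^sup>2\<close> is integrable.\<close>
  have A2: "set_integrable lborel {0..} (\<lambda>r. (A r)\<^sup>2 * r ^ (CARD('n) - 1))"
    unfolding set_integrable_def
  proof (rule Bochner_Integration.integrable_bound)
    show "integrable lborel (\<lambda>r. V * (indicator {0..} r *\<^sub>R (F r * r ^ (CARD('n) - 1))))"
      using F(1) unfolding set_integrable_def by (rule integrable_mult_right)
    show "AE r in lborel. norm (indicator {0..} r *\<^sub>R ((A r)\<^sup>2 * r ^ (CARD('n) - 1)))
        \<le> norm (V * (indicator {0..} r *\<^sub>R (F r * r ^ (CARD('n) - 1))))"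
    proof (intro AE_I2)
      fix r :: real
      have "(A r)\<^sup>2 * r ^ (CARD('n) - 1) \<le> V * (F r * r ^ (CARD('n) - 1))" if "0 \<le> r"
      proof -
        have "(A r)\<^sup>2 \<le> V * F r" using cs[OF that] V by (simp add: field_simps)
        from mult_right_mono[OF this, of "r ^ (CARD('n) - 1)"] that show ?thesis by (simp add: mult.assoc)
      qed
      then show "norm (indicator {0..} r *\<^sub>R ((A r)\<^sup>2 * r ^ (CARD('n) - 1)))
        \<le> norm (V * (indicator {0..} r *\<^sub>R (F r * r ^ (CARD('n) - 1))))"
        by (auto split: split_indicator)
    qed
  qed measurable
  then show ?int unfolding A_def .
  let ?g = "\<lambda>r. A r / V"
  have g: "?g \<in> radial_profiles" unfolding radial_profiles_def by (rule measurable_restrict_space1) measurable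
  have min: "M_dist f = radial_error f ?g"
  proof (rule antisym)
    show "M_dist f \<le> radial_error f ?g" unfolding M_dist_def by (rule INF_lower[OF g])
    \<comment> \<open>The comparison is pointwise in \<open>r\<close> under a nonnegative integral,
      which covers competitors of infinite error as well.\<close>
    show "radial_error f ?g \<le> M_dist f" unfolding M_dist_def
    proof (rule INF_greatest)
      fix g assume "g \<in> radial_profiles"
      with V show "radial_error f ?g \<le> radial_error f g"
        unfolding err[OF g] err[OF \<open>g \<in> radial_profiles\<close>] square
        by (intro nn_integral_mono) (auto intro!: ennreal_leI mult_right_mono split: split_indicator)
    qed
  qed
  with g show ?ex by auto
  have diff: "set_integrable lborel {0..} (\<lambda>r. F r * r ^ (CARD('n) - 1) - (A r)\<^sup>2 * r ^ (CARD('n) - 1) / V)"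
    by (intro set_integral_diff F(1)) (use A2 in simp)
  have nonneg: "0 \<le> F r * r ^ (CARD('n) - 1) - (A r)\<^sup>2 * r ^ (CARD('n) - 1) / V" if "0 \<le> r" for r
    using mult_right_mono[OF cs[OF that], of "r ^ (CARD('n) - 1)"] that by (simp add: algebra_simps)
  have "M_dist f = (\<integral>\<^sup>+r\<in>{0..}. ennreal (F r * r ^ (CARD('n) - 1) - (A r)\<^sup>2 * r ^ (CARD('n) - 1) / V) \<partial>lborel)"
    unfolding min err[OF g] square by (simp add: algebra_simps)
  also have "\<dots> = ennreal (LINT r:{0..}|lborel. F r * r ^ (CARD('n) - 1) - (A r)\<^sup>2 * r ^ (CARD('n) - 1) / V)"
    using diff nonneg by (intro nn_set_integral_eq_set_integral) auto
  also have D: "(LINT r:{0..}|lborel. F r * r ^ (CARD('n) - 1) - (A r)\<^sup>2 * r ^ (CARD('n) - 1) / V) = D1 f - D2 f"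
    unfolding D1_def D2_def F(2) A_def[symmetric] sphere_area_def[symmetric] V_def[symmetric]
    using A2 by (subst set_integral_diff(2)[OF F(1)]) simp_all
  finally have M: "M_dist f = ennreal (D1 f - D2 f)" .
  \<comment> \<open>\<open>ennreal\<close> would cut a negative difference off to 0; nonnegativity
    makes the extended real value equal to the real difference.\<close>
  have "0 \<le> D1 f - D2 f"
    unfolding D[symmetric] set_lebesgue_integral_def
    using nonneg by (intro Bochner_Integration.integral_nonneg) (auto split: split_indicator)
  with M show ?val by (simp add: enn2ereal_ennreal)
qed

section \<open>Hankel transforms in the plane\<close>

lemma angular_integral_mult_radial:
  fixes F :: "real ^ 'n::{finite,linorder} \<Rightarrow> real"
  assumes d: "2 \<le> CARD('n)" and r: "0 \<le> r"
  shows "angular_integral (\<lambda>\<omega>. F \<omega> * g (norm \<omega>)) r = angular_integral F r * g r"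
proof -
  have "angular_integral (\<lambda>\<omega>. F \<omega> * g (norm \<omega>)) r =
    (LINT \<theta>:angles CARD('n)|angle_measure CARD('n). spherical_version F r \<theta> * vol_elem CARD('n) 1 \<theta> * g r)"
    unfolding angular_integral_def spherical_version_def by (simp add: norm_from_spherical[OF d r] mult_ac)
  then show ?thesis unfolding angular_integral_def by simp
qed

section \<open>The Bessel function as a circle mean of cosines\<close>

text \<open>Meant for \<open>u t = a * cos t + b * sin t\<close> and \<open>v = u'\<close>. The
  product rule produces \<open>v\<^sup>2\<close>, and the conserved quantity \<open>s\<close>
  replaces it by \<open>s - u\<^sup>2\<close>, leaving only even powers of \<open>u\<close>.\<close>

lemma DERIV_oscillator_moment:
  fixes u v :: "real \<Rightarrow> real"
  assumes u: "DERIV u t :> v t" and v: "DERIV v t :> - u t" and uv: "(u t)\<^sup>2 + (v t)\<^sup>2 = s"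
  shows "DERIV (\<lambda>t. u t ^ (2 * k + 1) * v t) t :> real (2 * k + 1) * s * u t ^ (2 * k) - real (2 * k + 2) * u t ^ (2 * Suc k)"
proof (rule DERIV_cong[OF DERIV_mult[OF DERIV_power[OF u] v]])
  show "(real (2 * k + 1) * (v t * u t ^ (2 * k + 1 - Suc 0))) * v t + - u t * u t ^ (2 * k + 1) =
    real (2 * k + 1) * s * u t ^ (2 * k) - real (2 * k + 2) * u t ^ (2 * Suc k)"
    unfolding uv[symmetric] by (simp add: algebra_simps power2_eq_square)
qed

text \<open>Integrating the derivative of \<open>u\<^bsup>2k+1\<^esup> u'\<close> over a period gives a recursion in \<open>k\<close>.\<close>

lemma trig_moment:
  fixes a b :: real
  shows "(LINT t|lborel. (a * cos t + b * sin t) ^ (2 * k) * indicator {0..2 * pi} t) =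
    2 * pi * (fact (2 * k) / (4 ^ k * (fact k)\<^sup>2)) * (a\<^sup>2 + b\<^sup>2) ^ k"
proof (induction k)
  case 0
  then show ?case by simp
next
  case (Suc k)
  let ?u = "\<lambda>t. a * cos t + b * sin t" and ?v = "\<lambda>t. b * cos t - a * sin t"
  define I where "I j = (LINT t|lborel. ?u t ^ (2 * j) * indicator {0..2 * pi} t)" for j
  have int: "integrable lborel (\<lambda>t. ?u t ^ j * indicator {0..2 * pi} t)" for j
    using borel_integrable_atLeastAtMost'[of 0 "2 * pi" "\<lambda>t. ?u t ^ j"]
    by (simp add: set_integrable_def mult.commute continuous_intros)
  have uv: "(?u t)\<^sup>2 + (?v t)\<^sup>2 = a\<^sup>2 + b\<^sup>2" for t
  proof -
    have "(?u t)\<^sup>2 + (?v t)\<^sup>2 = (a\<^sup>2 + b\<^sup>2) * ((sin t)\<^sup>2 + (cos t)\<^sup>2)"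
      by (simp only: power2_eq_square) algebra
    then show ?thesis by simp
  qed
  let ?f = "\<lambda>t. (2 * k + 1) * (a\<^sup>2 + b\<^sup>2) * ?u t ^ (2 * k) - (2 * k + 2) * ?u t ^ (2 * Suc k)"
  have "(LINT t|lborel. ?f t * indicator {0..2 * pi} t) = ?u (2 * pi) ^ (2 * k + 1) * ?v (2 * pi) - ?u 0 ^ (2 * k + 1) * ?v 0"
  proof (rule integral_FTC_Icc_real)
    fix t :: real
    have "DERIV ?u t :> ?v t" "DERIV ?v t :> - ?u t"
      by (auto intro!: derivative_eq_intros)
    then show "DERIV (\<lambda>t. ?u t ^ (2 * k + 1) * ?v t) t :> ?f t"
      by (rule DERIV_oscillator_moment[where u="?u" and v="?v", OF _ _ uv])
    show "isCont ?f t" by (intro continuous_intros)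
  qed simp
  \<comment> \<open>The boundary terms agree because \<open>u\<close> and \<open>v\<close> have
    period 2 \<pi>.\<close>
  also have "\<dots> = 0" by simp
  also have "(LINT t|lborel. ?f t * indicator {0..2 * pi} t) =
    (LINT t|lborel. (2 * k + 1) * (a\<^sup>2 + b\<^sup>2) * (?u t ^ (2 * k) * indicator {0..2 * pi} t)
      - (2 * k + 2) * (?u t ^ (2 * Suc k) * indicator {0..2 * pi} t))"
    by (intro Bochner_Integration.integral_cong) (simp_all add: algebra_simps)
  also have "\<dots> = (2 * k + 1) * (a\<^sup>2 + b\<^sup>2) * I k - (2 * k + 2) * I (Suc k)"
    unfolding I_def
    by (subst Bochner_Integration.integral_diff) (use int in \<open>simp_all only: integrable_mult_right integral_mult_right_zero\<close>)
  finally have "I (Suc k) = (2 * k + 1) * (a\<^sup>2 + b\<^sup>2) * I k / (2 * k + 2)"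
    by (simp add: field_simps)
  also have "\<dots> = 2 * pi * (fact (2 * Suc k) / (4 ^ Suc k * (fact (Suc k))\<^sup>2)) * (a\<^sup>2 + b\<^sup>2) ^ Suc k"
  proof -
    \<comment> \<open>The fraction arithmetic with atoms: \<open>L\<close> is k + 1,
      \<open>S\<close> is a^2 + b^2, \<open>Q\<close> is S^k, \<open>P\<close> is 4^k, and
      \<open>F\<close>, \<open>F'\<close> are the factorials of k and 2k.\<close>
    have gen: "(2 * L - 1) * S * (2 * pi * (F' / (P * F\<^sup>2)) * Q) / (2 * L) =
        2 * pi * (2 * L * (2 * L - 1) * F' / (4 * P * (L * F)\<^sup>2)) * (S * Q)"
      if "L \<noteq> 0" "F \<noteq> 0" "P \<noteq> 0" for L S F' P F Q :: real
      using that by (simp add: field_simps power2_eq_square)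
    have L: "real (2 * k + 1) = 2 * real (Suc k) - 1" "real (2 * k + 2) = 2 * real (Suc k)" by simp_all
    have "(fact (2 * Suc k) :: real) = 2 * real (Suc k) * (2 * real (Suc k) - 1) * fact (2 * k)"
      by (simp add: algebra_simps)
    moreover have "(fact (Suc k) :: real) = real (Suc k) * fact k" by simp
    ultimately show ?thesis
      unfolding I_def Suc.IH L power_Suc[of 4] power_Suc[of "a\<^sup>2 + b\<^sup>2"]
      by (simp only:) (rule gen; simp)
  qed
  finally show ?case unfolding I_def .
qed

text \<open>In the cosine series, the factorial of 2k in the denominator cancels the one in the
  2k-th moment from \<open>trig_moment\<close>. What remains is the series of J_0 at the amplitude
  of the wave.\<close>

lemma integral_cos_circle:
  fixes a b :: real
  shows "(LINT t:{0..<2 * pi}|lborel. cos (a * cos t + b * sin t)) = 2 * pi * bessel_J0 (sqrt (a\<^sup>2 + b\<^sup>2))"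
proof -
  let ?u = "\<lambda>t. a * cos t + b * sin t"
  define f where "f k t = (- 1) ^ k / fact (2 * k) * (?u t ^ (2 * k) * indicator {0..2 * pi} t)" for k t
  define R where "R = \<bar>a\<bar> + \<bar>b\<bar>"
  have u: "\<bar>?u t\<bar> \<le> R" for t
    unfolding R_def using abs_triangle_ineq[of "a * cos t" "b * sin t"]
      mult_left_mono[OF abs_cos_le_one[of t], of "\<bar>a\<bar>"] mult_left_mono[OF abs_sin_le_one[of t], of "\<bar>b\<bar>"]
    by (simp add: abs_mult)
  have int_u: "integrable lborel (\<lambda>t. ?u t ^ j * indicator {0..2 * pi} t)" for j
    using borel_integrable_atLeastAtMost'[of 0 "2 * pi" "\<lambda>t. ?u t ^ j"]
    by (simp add: set_integrable_def mult.commute continuous_intros)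
  have int: "integrable lborel (f k)" for k unfolding f_def by (intro integrable_mult_right int_u)
  \<comment> \<open>Since (2k)! \<ge> k!, the exponential series of \<open>R\<^sup>2\<close>
    dominates uniformly in \<open>t\<close>, which justifies termwise integration.\<close>
  have bound: "norm (f k t) \<le> (R\<^sup>2) ^ k / fact k * indicator {0..2 * pi} t" for k t
  proof -
    have "\<bar>?u t\<bar> ^ (2 * k) / fact (2 * k) \<le> R ^ (2 * k) / fact k"
      by (intro frac_le power_mono u fact_mono) auto
    then show ?thesis by (auto simp: f_def power_mult abs_mult power_abs split: split_indicator)
  qed
  have summ: "summable (\<lambda>k. (R\<^sup>2) ^ k / fact k)"
    using summable_exp[of "R\<^sup>2"] by (simp add: field_simps)
  \<comment> \<open>The moments are taken over the closed interval, to which the fundamental theorem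
    applies; the endpoint is a null set.\<close>
  have "(LINT t:{0..<2 * pi}|lborel. cos (?u t)) = (LINT t|lborel. cos (?u t) * indicator {0..2 * pi} t)"
    unfolding set_lebesgue_integral_def
    by (rule integral_cong_AE, measurable, use AE_lborel_singleton[of "2 * pi"] in eventually_elim)
      (auto split: split_indicator)
  also have "\<dots> = (LINT t|lborel. (\<Sum>k. f k t))"
  proof (rule Bochner_Integration.integral_cong[OF refl])
    fix t :: real
    have "(\<lambda>k. (- 1) ^ k / fact (2 * k) * ?u t ^ (2 * k)) sums cos (?u t)"
      by (rule cos_paired)
    from sums_unique[OF sums_mult2[OF this, of "indicator {0..2 * pi} t"]]
    show "cos (?u t) * indicator {0..2 * pi} t = (\<Sum>k. f k t)"
      by (simp only: f_def mult.assoc)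
  qed
  also have "\<dots> = (\<Sum>k. LINT t|lborel. f k t)"
  proof (rule integral_suminf[OF int])
    show "AE t in lborel. summable (\<lambda>k. norm (f k t))"
    proof (rule AE_I2)
      fix t :: real
      have "summable (\<lambda>k. (R\<^sup>2) ^ k / fact k * indicator {0..2 * pi} t)"
        by (rule summable_mult2[OF summ])
      then show "summable (\<lambda>k. norm (f k t))"
        by (rule summable_comparison_test'[where N=0]) (use bound in simp)
    qed
    have mono: "(LINT t|lborel. norm (f k t)) \<le> (R\<^sup>2) ^ k / fact k * (2 * pi)" for k
    proof -
      have ind: "integrable lborel (\<lambda>t::real. indicator {0..2 * pi} t :: real)" by simp
      have "(LINT t|lborel. norm (f k t)) \<le> (LINT t|lborel. (R\<^sup>2) ^ k / fact k * indicator {0..2 * pi} t)"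
        by (intro integral_mono integrable_norm int bound integrable_mult_right ind)
      also have "\<dots> = (R\<^sup>2) ^ k / fact k * (LINT t|lborel. indicator {0..2 * pi} t)"
        by (rule integral_mult_right_zero)
      finally show ?thesis by simp
    qed
    have "summable (\<lambda>k. (R\<^sup>2) ^ k / fact k * (2 * pi))" by (rule summable_mult2[OF summ])
    then show "summable (\<lambda>k. LINT t|lborel. norm (f k t))"
      by (rule summable_comparison_test'[where N=0]) (use mono in simp)
  qed
  also have "\<dots> = (\<Sum>k. 2 * pi * ((- 1) ^ k / (fact k)\<^sup>2 * (sqrt (a\<^sup>2 + b\<^sup>2) / 2) ^ (2 * k)))"
  proof (intro suminf_cong)
    fix k
    have "(sqrt (a\<^sup>2 + b\<^sup>2) / 2) ^ (2 * k) = (a\<^sup>2 + b\<^sup>2) ^ k / 4 ^ k"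
      by (simp add: power_mult power_divide)
    then have "2 * pi * ((- 1) ^ k / (fact k)\<^sup>2 * (sqrt (a\<^sup>2 + b\<^sup>2) / 2) ^ (2 * k)) =
      (- 1) ^ k / fact (2 * k) * (2 * pi * (fact (2 * k) / (4 ^ k * (fact k)\<^sup>2)) * (a\<^sup>2 + b\<^sup>2) ^ k)"
      by (simp add: mult_ac)
    also have "\<dots> = (LINT t|lborel. f k t)"
      unfolding trig_moment[symmetric] f_def by (rule integral_mult_right_zero[symmetric])
    finally show "(LINT t|lborel. f k t) = 2 * pi * ((- 1) ^ k / (fact k)\<^sup>2 * (sqrt (a\<^sup>2 + b\<^sup>2) / 2) ^ (2 * k))" ..
  qed
  also have "\<dots> = 2 * pi * bessel_J0 (sqrt (a\<^sup>2 + b\<^sup>2))"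
    unfolding bessel_J0_def
  proof (rule suminf_mult)
    let ?x = "sqrt (a\<^sup>2 + b\<^sup>2)"
    show "summable (\<lambda>k. (- 1) ^ k / (fact k)\<^sup>2 * (?x / 2) ^ (2 * k))"
    proof (rule summable_comparison_test')
      show "summable (\<lambda>k. ((?x / 2)\<^sup>2) ^ k / fact k)"
        using summable_exp[of "(?x / 2)\<^sup>2"] by (simp add: field_simps)
      fix k
      have "(1 :: real) * fact k \<le> fact k * fact k" by (intro mult_right_mono) auto
      then have "\<bar>?x / 2\<bar> ^ (2 * k) / (fact k)\<^sup>2 \<le> \<bar>?x / 2\<bar> ^ (2 * k) / fact k"
        by (intro divide_left_mono) (auto simp: power2_eq_square)
      then show "norm ((- 1) ^ k / (fact k)\<^sup>2 * (?x / 2) ^ (2 * k)) \<le> ((?x / 2)\<^sup>2) ^ k / fact k"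
        by (simp add: abs_mult power_abs power_mult)
    qed
  qed
  finally show ?thesis .
qed

text \<open>A mean of cosines has absolute value at most 1. \<open>integral_cos_circle\<close> with
  b = 0 produces the argument \<open>\<bar>x\<bar>\<close>, hence the initial appeal to evenness of
  the series.\<close>

lemma abs_bessel_J0_le_1: "\<bar>bessel_J0 x\<bar> \<le> 1"
proof -
  have "bessel_J0 x = bessel_J0 \<bar>x\<bar>" by (simp add: bessel_J0_def power_mult power_divide)
  moreover have "2 * pi * \<bar>bessel_J0 \<bar>x\<bar>\<bar> \<le> 2 * pi"
  proof -
    have "\<bar>LINT t:{0..<2 * pi}|lborel. cos (x * cos t + 0 * sin t)\<bar> \<le> (LINT t:{0..<2 * pi}|lborel. 1)"
      unfolding set_lebesgue_integral_def
    proof (rule integral_abs_bound_integral)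
      show one: "integrable lborel (\<lambda>t. indicator {0..<2 * pi} t *\<^sub>R (1 :: real))" by simp
      show "integrable lborel (\<lambda>t. indicator {0..<2 * pi} t *\<^sub>R cos (x * cos t + 0 * sin t))"
        by (rule Bochner_Integration.integrable_bound[OF one]) (measurable, auto split: split_indicator)
    qed (auto split: split_indicator)
    then show ?thesis
      unfolding integral_cos_circle by (simp add: abs_mult set_lebesgue_integral_def)
  qed
  ultimately show ?thesis by simp
qed

lemma measurable_bessel_J0 [measurable]: "bessel_J0 \<in> borel_measurable borel"
  unfolding bessel_J0_def by measurable

lemma integral_angles_2:
  assumes [measurable]: "F \<in> borel_measurable borel"
  shows "(LINT \<theta>:angles 2|angle_measure 2. F (\<theta> 1) :: real) = (LINT t:{0..<2 * pi}|lborel. F t)"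
proof -
  interpret product_sigma_finite "\<lambda>k::nat. lborel :: real measure" ..
  have I: "{1..<2::nat} = {1}" by auto
  have "(LINT \<theta>:angles 2|angle_measure 2. F (\<theta> 1)) =
    (LINT \<theta>|angle_measure 2. (\<lambda>t. indicator {0..<2 * pi} t *\<^sub>R F t) (\<theta> 1))"
    unfolding set_lebesgue_integral_def
  proof (rule Bochner_Integration.integral_cong[OF refl])
    fix \<theta> assume "\<theta> \<in> space (angle_measure 2)"
    then have "\<theta> \<in> extensional {1}" unfolding angle_measure_def I by (auto simp: space_PiM PiE_def)
    then have "indicator (angles 2) \<theta> = (indicator {0..<2*pi} (\<theta> 1) :: real)"
      unfolding angles_def I by (auto simp: PiE_iff split: split_indicator)
    then show "indicator (angles 2) \<theta> *\<^sub>R F (\<theta> 1) = (\<lambda>t. indicator {0..<2 * pi} t *\<^sub>R F t) (\<theta> 1)" by simp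
  qed
  also have "\<dots> = (LINT t:{0..<2 * pi}|lborel. F t)"
    unfolding angle_measure_def I set_lebesgue_integral_def by (rule product_integral_singleton) measurable
  finally show ?thesis .
qed

section \<open>Circle means of cosine transforms\<close>

text \<open>On the circle of radius \<open>r\<close>, the inner product with \<open>h\<close> is a
  wave a cos t + b sin t of amplitude \<open>r * norm h\<close>, and the planar Jacobian is 1 at
  unit radius.\<close>

lemma angular_integral_cos:
  fixes h :: "real ^ 'n::{finite,linorder}"
  assumes d: "CARD('n) = 2" and r: "0 \<le> r"
  shows "angular_integral (\<lambda>\<omega>. cos (\<omega> \<bullet> h)) r = 2 * pi * bessel_J0 (r * norm h)"
proof -
  define c where "c = inv_into UNIV (coord_num :: 'n \<Rightarrow> nat)"
  have c: "c (coord_num i) = i" for i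
    using bij_betw_coord_num[where 'n='n] unfolding c_def by (auto simp: bij_betw_def)
  have sum2: "(\<Sum>i\<in>UNIV. G (coord_num (i :: 'n))) = G 1 + (G 2 :: real)" for G
  proof -
    have "{1..2::nat} = {1, 2}" by auto
    then show ?thesis using sum.reindex_bij_betw[OF bij_betw_coord_num[where 'n='n], of G] d by simp
  qed
  let ?a = "h $ c 1" and ?b = "h $ c 2"
  have inner: "(from_spherical r \<theta> :: (real, 'n) vec) \<bullet> h = r * ?a * cos (\<theta> 1) + r * ?b * sin (\<theta> 1)" for \<theta>
  proof -
    have "(from_spherical r \<theta> :: (real, 'n) vec) \<bullet> h =
        (\<Sum>i\<in>UNIV. sph_coord 2 r \<theta> (coord_num (i :: 'n)) * h $ c (coord_num i))"
      unfolding inner_vec_def c from_spherical_eq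
      by (simp only: vec_lambda_beta restrict_apply coord_num_mem if_True inner_real_def) (simp only: d)
    then show ?thesis
      by (subst (asm) sum2[of "\<lambda>k. sph_coord 2 r \<theta> k * h $ c k"]) (simp add: sph_coord_def)
  qed
  have "(norm h)\<^sup>2 = (\<Sum>i\<in>UNIV. (h $ c (coord_num (i :: 'n)))\<^sup>2)"
    unfolding c by (simp add: norm_vec_def L2_set_def sum_nonneg)
  also have "\<dots> = ?a\<^sup>2 + ?b\<^sup>2" by (rule sum2[of "\<lambda>k. (h $ c k)\<^sup>2"])
  finally have norm: "sqrt ((r * ?a)\<^sup>2 + (r * ?b)\<^sup>2) = r * norm h"
    using r by (intro real_sqrt_unique) (auto simp: power_mult_distrib algebra_simps)
  have "angular_integral (\<lambda>\<omega>. cos (\<omega> \<bullet> h)) r =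
    (LINT \<theta>:angles 2|angle_measure 2. cos (r * ?a * cos (\<theta> 1) + r * ?b * sin (\<theta> 1)))"
    unfolding angular_integral_def spherical_version_def d inner by (simp add: vol_elem_def)
  also have "\<dots> = (LINT t:{0..<2 * pi}|lborel. cos (r * ?a * cos t + r * ?b * sin t))"
    by (rule integral_angles_2) measurable
  finally show ?thesis unfolding integral_cos_circle norm .
qed

lemma integrable_mult_bessel_J0:
  fixes F :: "real ^ 'n::{finite,linorder} \<Rightarrow> real"
  assumes "integrable lborel F"
  shows "integrable lborel (\<lambda>\<omega>. F \<omega> * bessel_J0 (r * norm \<omega>))"
  using assms
proof (rule Bochner_Integration.integrable_bound)
  show "(\<lambda>\<omega>. F \<omega> * bessel_J0 (r * norm \<omega>)) \<in> borel_measurable lborel"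
    using borel_measurable_integrable[OF assms] by measurable
  show "AE \<omega> in lborel. norm (F \<omega> * bessel_J0 (r * norm \<omega>)) \<le> norm (F \<omega>)"
    by (intro AE_I2) (simp add: abs_mult mult_left_le abs_bessel_J0_le_1)
qed

text \<open>Fubini lets the circle mean act on the plane wave, which it turns into J_0. The factor
  \<open>\<kappa>\<close> serves both directions of the Fourier pair: 1 from covariance to density,
  1 / (2 \<pi>)^2 back.\<close>

lemma angular_integral_cos_transform:
  fixes F G :: "real ^ 'n::{finite,linorder} \<Rightarrow> real"
  assumes d: "CARD('n) = 2" and F: "integrable lborel F" and r: "0 \<le> r"
    and G: "\<And>\<omega>. G \<omega> = \<kappa> * (LINT h|lborel. cos (\<omega> \<bullet> h) * F h)"
  shows "angular_integral G r = 2 * pi * \<kappa> * (LINT h|lborel. F h * bessel_J0 (r * norm h))"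
proof -
  let ?A = "angle_measure CARD('n)" and ?S = "angles CARD('n)"
  interpret A: sigma_finite_measure ?A by (rule sigma_finite_angle_measure)
  interpret P: pair_sigma_finite ?A "lborel :: (real, 'n) vec measure" ..
  have d2: "2 \<le> CARD('n)" using d by simp
  note [measurable (raw)] = measurable_from_spherical[OF _ _ d2]
  note [measurable] = borel_measurable_integrable[OF F]
  have vol: "vol_elem CARD('n) 1 \<theta> = 1" for \<theta> by (simp add: vol_elem_def d)
  let ?K = "\<lambda>\<theta> h. indicator ?S \<theta> * (cos (from_spherical r \<theta> \<bullet> h) * F h)"
  have K_int: "integrable lborel (?K \<theta>)" if [measurable]: "\<theta> \<in> space ?A" for \<theta>
  proof (rule Bochner_Integration.integrable_bound[OF F])
    show "?K \<theta> \<in> borel_measurable lborel" by measurable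
    show "AE h in lborel. norm (?K \<theta> h) \<le> norm (F h)"
      by (intro AE_I2) (auto simp: abs_mult mult_left_le_one_le split: split_indicator)
  qed
  \<comment> \<open>The kernel is dominated by
    \<open>indicator ?S \<theta> * \<bar>F h\<bar>\<close>, and the angle set has finite
    measure.\<close>
  have "integrable (?A \<Otimes>\<^sub>M lborel) (case_prod ?K)"
  proof (rule P.Fubini_integrable)
    show "case_prod ?K \<in> borel_measurable (?A \<Otimes>\<^sub>M lborel)" by measurable
    show "AE \<theta> in ?A. integrable lborel (\<lambda>h. case_prod ?K (\<theta>, h))"
      using K_int by (intro AE_I2) (simp only: prod.case)
    show "integrable ?A (\<lambda>\<theta>. LINT h|lborel. norm (case_prod ?K (\<theta>, h)))"
    proof (rule Bochner_Integration.integrable_bound)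
      show "integrable ?A (\<lambda>\<theta>. indicator ?S \<theta> * (LINT h|lborel. norm (F h)))"
        using emeasure_angles_finite by (intro integrable_mult_left integrable_real_indicator) auto
      show "AE \<theta> in ?A. norm (LINT h|lborel. norm (case_prod ?K (\<theta>, h))) \<le> norm (indicator ?S \<theta> * (LINT h|lborel. norm (F h)))"
      proof (intro AE_I2)
        fix \<theta> assume \<theta>: "\<theta> \<in> space ?A"
        have "(LINT h|lborel. norm (?K \<theta> h)) \<le> (LINT h|lborel. indicator ?S \<theta> * norm (F h))"
          using F K_int[OF \<theta>]
          by (intro integral_mono integrable_norm integrable_mult_right)
            (auto simp: abs_mult mult_left_le_one_le split: split_indicator)
        then show "norm (LINT h|lborel. norm (case_prod ?K (\<theta>, h))) \<le> norm (indicator ?S \<theta> * (LINT h|lborel. norm (F h)))"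
          by (simp add: abs_mult)
      qed
    qed measurable
  qed
  from P.Fubini_integral[OF this]
  have swap: "(LINT \<theta>|?A. LINT h|lborel. ?K \<theta> h) = (LINT h|lborel. LINT \<theta>|?A. ?K \<theta> h)" ..
  have "angular_integral G r = \<kappa> * (LINT \<theta>|?A. LINT h|lborel. ?K \<theta> h)"
    unfolding angular_integral_def spherical_version_def set_lebesgue_integral_def G vol
    by (simp add: mult_ac flip: integral_mult_right_zero)
  also have "\<dots> = \<kappa> * (LINT h|lborel. F h * angular_integral (\<lambda>\<omega>. cos (\<omega> \<bullet> h)) r)"
    unfolding swap angular_integral_def spherical_version_def set_lebesgue_integral_def vol
    by (simp add: mult_ac flip: integral_mult_right_zero)
  also have "\<dots> = \<kappa> * (LINT h|lborel. 2 * pi * (F h * bessel_J0 (r * norm h)))"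
    by (simp add: angular_integral_cos[OF d r] mult_ac)
  finally show ?thesis by simp
qed

section \<open>The Hankel pairing and its Parseval identity\<close>

lemma abs_integral_mult_bessel_J0_le:
  fixes F :: "real ^ 'n::{finite,linorder} \<Rightarrow> real"
  assumes "integrable lborel F"
  shows "\<bar>LINT \<omega>|lborel. F \<omega> * bessel_J0 (r * norm \<omega>)\<bar> \<le> (LINT \<omega>|lborel. \<bar>F \<omega>\<bar>)"
  by (rule integral_abs_bound_integral)
    (use assms in \<open>auto simp: abs_mult mult_left_le abs_bessel_J0_le_1 intro!: integrable_mult_bessel_J0\<close>)

text \<open>As |J_0| \<le> 1, a Hankel transform is bounded by the L1 norm of its argument, and the
  double kernel by |F x| |G y|.\<close>

lemma integrable_mult_hankel:
  fixes F G :: "real ^ 'n::{finite,linorder} \<Rightarrow> real"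
  assumes F: "integrable lborel F" and G: "integrable lborel G"
  shows "integrable lborel (\<lambda>x. F x * (LINT y|lborel. G y * bessel_J0 (norm x * norm y)))"
    and "integrable (lborel \<Otimes>\<^sub>M lborel) (\<lambda>(x, y). F x * (G y * bessel_J0 (norm x * norm y)))"
proof -
  note [measurable] = borel_measurable_integrable[OF F] borel_measurable_integrable[OF G]
  show "integrable lborel (\<lambda>x. F x * (LINT y|lborel. G y * bessel_J0 (norm x * norm y)))"
  proof (rule Bochner_Integration.integrable_bound)
    show "integrable lborel (\<lambda>x. F x * (LINT y|lborel. \<bar>G y\<bar>))"
      using F by (rule integrable_mult_left)
    show "AE x in lborel. norm (F x * (LINT y|lborel. G y * bessel_J0 (norm x * norm y)))
        \<le> norm (F x * (LINT y|lborel. \<bar>G y\<bar>))"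
      by (intro AE_I2) (auto simp: abs_mult intro!: mult_left_mono
        order_trans[OF abs_integral_mult_bessel_J0_le[OF G]])
  qed measurable
  show "integrable (lborel \<Otimes>\<^sub>M lborel) (\<lambda>(x, y). F x * (G y * bessel_J0 (norm x * norm y)))"
  proof (rule lborel_pair.Fubini_integrable)
    show "AE x in lborel. integrable lborel (\<lambda>y. case (x, y) of (x, y) \<Rightarrow> F x * (G y * bessel_J0 (norm x * norm y)))"
      using integrable_mult_bessel_J0[OF G] by (intro AE_I2) simp
    show "integrable lborel (\<lambda>x. LINT y|lborel. norm (case (x, y) of (x, y) \<Rightarrow> F x * (G y * bessel_J0 (norm x * norm y))))"
    proof (rule Bochner_Integration.integrable_bound)
      show "integrable lborel (\<lambda>x. F x * (LINT y|lborel. \<bar>G y\<bar>))"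
        using F by (rule integrable_mult_left)
      show "AE x in lborel. norm (LINT y|lborel. norm (case (x, y) of (x, y) \<Rightarrow> F x * (G y * bessel_J0 (norm x * norm y))))
        \<le> norm (F x * (LINT y|lborel. \<bar>G y\<bar>))"
      proof (intro AE_I2)
        fix x
        have "(LINT y|lborel. norm (F x * (G y * bessel_J0 (norm x * norm y)))) \<le> (LINT y|lborel. \<bar>F x\<bar> * \<bar>G y\<bar>)"
          using integrable_mult_bessel_J0[OF G, of "norm x"] G
          by (intro integral_mono integrable_norm integrable_mult_right)
            (auto simp: abs_mult mult.assoc intro!: mult_left_mono mult_left_le abs_bessel_J0_le_1)
        then show "norm (LINT y|lborel. norm (case (x, y) of (x, y) \<Rightarrow> F x * (G y * bessel_J0 (norm x * norm y))))
          \<le> norm (F x * (LINT y|lborel. \<bar>G y\<bar>))"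
          by (simp add: abs_mult)
      qed
    qed measurable
  qed measurable
qed

text \<open>The kernel \<open>bessel_J0 (norm x * norm y)\<close> is symmetric, so Fubini moves the
  transform from one factor to the other.\<close>

lemma hankel_adjoint:
  fixes F G :: "real ^ 'n::{finite,linorder} \<Rightarrow> real"
  assumes F: "integrable lborel F" and G: "integrable lborel G"
  shows "(LINT x|lborel. F x * (LINT y|lborel. G y * bessel_J0 (norm x * norm y))) =
    (LINT y|lborel. G y * (LINT x|lborel. F x * bessel_J0 (norm y * norm x)))"
proof -
  let ?K = "\<lambda>x y. F x * (G y * bessel_J0 (norm x * norm y))"
  have "(LINT x|lborel. F x * (LINT y|lborel. G y * bessel_J0 (norm x * norm y))) =
      (LINT x|lborel. LINT y|lborel. ?K x y)"
    by (simp only: integral_mult_right_zero)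
  also have "\<dots> = (LINT y|lborel. LINT x|lborel. ?K x y)"
    by (rule lborel_pair.Fubini_integral[OF integrable_mult_hankel(2)[OF F G], symmetric])
  also have "\<dots> = (LINT y|lborel. LINT x|lborel. G y * (F x * bessel_J0 (norm y * norm x)))"
    by (intro Bochner_Integration.integral_cong refl) (simp add: mult_ac)
  also have "\<dots> = (LINT y|lborel. G y * (LINT x|lborel. F x * bessel_J0 (norm y * norm x)))"
    by (simp only: integral_mult_right_zero)
  finally show ?thesis .
qed

lemma hankel_parseval:
  fixes F G :: "real ^ 'n::{finite,linorder} \<Rightarrow> real"
  assumes d: "CARD('n) = 2" and F: "integrable lborel F" and G: "integrable lborel G"
    and F_eq: "\<And>\<omega>. F \<omega> = (LINT h|lborel. cos (\<omega> \<bullet> h) * G h)"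
    and G_eq: "\<And>h. G h = 1 / (2 * pi)\<^sup>2 * (LINT \<omega>|lborel. cos (h \<bullet> \<omega>) * F \<omega>)"
  shows "set_integrable lborel {0..} (\<lambda>r. (LINT \<omega>|lborel. F \<omega> * bessel_J0 (r * norm \<omega>))\<^sup>2 * r)"
    and "(LINT r:{0..}|lborel. (angular_integral F r)\<^sup>2 * r) =
      (LINT r:{0..}|lborel. (LINT \<omega>|lborel. F \<omega> * bessel_J0 (r * norm \<omega>))\<^sup>2 * r)"
proof -
  have d2: "2 \<le> CARD('n)" using d by simp
  define HF where "HF r = (LINT \<omega>|lborel. F \<omega> * bessel_J0 (r * norm \<omega>))" for r
  define HG where "HG r = (LINT h|lborel. G h * bessel_J0 (r * norm h))" for r
  have F_ang: "angular_integral F r = 2 * pi * HG r" if "0 \<le> r" for r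
    using angular_integral_cos_transform[OF d G that, of F 1] F_eq by (simp add: HG_def)
  \<comment> \<open>The factor is 2 \<pi> from the circle times 1 / (2 \<pi>)^2 from the inverse
    transform.\<close>
  have G_ang: "angular_integral G r = HF r / (2 * pi)" if "0 \<le> r" for r
    using angular_integral_cos_transform[OF d F that G_eq] by (simp add: HF_def power2_eq_square)
  note sF = spherical_integral[OF d2 integrable_mult_hankel(1)[OF F G], folded HG_def]
  note sG = spherical_integral[OF d2 integrable_mult_hankel(1)[OF G F], folded HF_def]
  \<comment> \<open>Each pairing becomes a square: \<open>HG\<close> is the angular integral of
    \<open>F\<close> up to the factor 2 \<pi>, and in \<open>G_int\<close> the angular integral of
    \<open>G\<close> is \<open>HF\<close> up to its inverse.\<close>
  have F_int: "angular_integral (\<lambda>\<omega>. F \<omega> * HG (norm \<omega>)) r * r ^ (CARD('n) - 1) =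
      1 / (2 * pi) * ((angular_integral F r)\<^sup>2 * r)" if "0 \<le> r" for r
    unfolding angular_integral_mult_radial[OF d2 that] by (simp add: F_ang[OF that] d power2_eq_square)
  have G_int: "angular_integral (\<lambda>h. G h * HF (norm h)) r * r ^ (CARD('n) - 1) =
      1 / (2 * pi) * ((HF r)\<^sup>2 * r)" if "0 \<le> r" for r
    unfolding angular_integral_mult_radial[OF d2 that] by (simp add: G_ang[OF that] d power2_eq_square)
  \<comment> \<open>Square integrability of the Hankel transform is a by-product: its weighted
    square is the radial density of the integrable function
    \<open>G h * HF (norm h)\<close>.\<close>
  have "set_integrable lborel {0..} (\<lambda>r. 1 / (2 * pi) * ((HF r)\<^sup>2 * r))"
    using sG(1) by (subst set_integrable_cong[OF refl refl G_int[symmetric]]) auto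
  then show "set_integrable lborel {0..} (\<lambda>r. (LINT \<omega>|lborel. F \<omega> * bessel_J0 (r * norm \<omega>))\<^sup>2 * r)"
    unfolding HF_def by simp
  have "1 / (2 * pi) * (LINT r:{0..}|lborel. (angular_integral F r)\<^sup>2 * r) = (LINT \<omega>|lborel. F \<omega> * HG (norm \<omega>))"
    unfolding sF(2) set_integral_mult_right[symmetric]
    by (rule set_lebesgue_integral_cong) (simp, use F_int in force)
  also have "\<dots> = (LINT h|lborel. G h * HF (norm h))"
    unfolding HF_def HG_def by (rule hankel_adjoint[OF F G])
  also have "\<dots> = 1 / (2 * pi) * (LINT r:{0..}|lborel. (HF r)\<^sup>2 * r)"
    unfolding sG(2) set_integral_mult_right[symmetric]
    by (rule set_lebesgue_integral_cong) (simp, use G_int in force)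
  finally show "(LINT r:{0..}|lborel. (angular_integral F r)\<^sup>2 * r) =
      (LINT r:{0..}|lborel. (LINT \<omega>|lborel. F \<omega> * bessel_J0 (r * norm \<omega>))\<^sup>2 * r)"
    unfolding HF_def by simp
qed

section \<open>From the complex Fourier pair to cosine transforms\<close>

lemma Re_integral_exp_mult:
  fixes g :: "'a::euclidean_space \<Rightarrow> real" and \<phi> :: "'a \<Rightarrow> real"
  assumes g: "integrable lborel g" and [measurable]: "\<phi> \<in> borel_measurable borel"
  shows "Re (LINT h|lborel. exp (\<i> * complex_of_real (\<phi> h)) * complex_of_real (g h)) = (LINT h|lborel. cos (\<phi> h) * g h)"
proof -
  have "integrable lborel (\<lambda>h. exp (\<i> * complex_of_real (\<phi> h)) * complex_of_real (g h))"
  proof (rule Bochner_Integration.integrable_bound[OF g])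
    show "(\<lambda>h. exp (\<i> * complex_of_real (\<phi> h)) * complex_of_real (g h)) \<in> borel_measurable lborel"
      using borel_measurable_integrable[OF g] by measurable
  qed (simp add: norm_mult)
  from integral_Re[OF this] show ?thesis by (simp add: Re_exp)
qed

text \<open>Both functions are real, so taking real parts loses nothing; evenness of the cosine
  removes the sign in the forward transform.\<close>

lemma spectral_density_cos:
  fixes f :: "real ^ 'n \<Rightarrow> real"
  assumes "spectral_density M Z f"
  shows "f \<omega> = (LINT h|lborel. cos (\<omega> \<bullet> h) * cov_fun M Z h)"
    and "cov_fun M Z h = 1 / (2 * pi) ^ CARD('n) * (LINT \<omega>|lborel. cos (h \<bullet> \<omega>) * f \<omega>)"
proof -
  have c: "integrable lborel (cov_fun M Z)" and f: "integrable lborel f"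
    and f_all: "\<forall>\<omega>. complex_of_real (f \<omega>) =
        (LINT h|lborel. exp (- \<i> * complex_of_real (\<omega> \<bullet> h)) * complex_of_real (cov_fun M Z h))"
    and c_all: "\<forall>h. complex_of_real (cov_fun M Z h) = complex_of_real (1 / (2 * pi) ^ CARD('n)) *
        (LINT \<omega>|lborel. exp (\<i> * complex_of_real (\<omega> \<bullet> h)) * complex_of_real (f \<omega>))"
    using assms unfolding spectral_density_def by blast+
  have f_eq: "complex_of_real (f \<omega>) =
      (LINT h|lborel. exp (\<i> * complex_of_real (- (\<omega> \<bullet> h))) * complex_of_real (cov_fun M Z h))"
    by (rule trans[OF spec[OF f_all]]) simp
  have c_eq: "complex_of_real (cov_fun M Z h) = complex_of_real (1 / (2 * pi) ^ CARD('n)) *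
      (LINT \<omega>|lborel. exp (\<i> * complex_of_real (h \<bullet> \<omega>)) * complex_of_real (f \<omega>))"
    by (rule trans[OF spec[OF c_all]]) (simp only: inner_commute)
  have "f \<omega> = Re (complex_of_real (f \<omega>))" by simp
  also have "\<dots> = (LINT h|lborel. cos (- (\<omega> \<bullet> h)) * cov_fun M Z h)"
    unfolding f_eq by (rule Re_integral_exp_mult[OF c]) measurable
  finally show "f \<omega> = (LINT h|lborel. cos (\<omega> \<bullet> h) * cov_fun M Z h)" by simp
  have Re_mult: "Re (complex_of_real a * z) = a * Re z" for a z by simp
  have "cov_fun M Z h = Re (complex_of_real (cov_fun M Z h))" by simp
  also have "\<dots> = 1 / (2 * pi) ^ CARD('n) * (LINT \<omega>|lborel. cos (h \<bullet> \<omega>) * f \<omega>)"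
    unfolding c_eq Re_mult by (subst Re_integral_exp_mult[OF f]) measurable
  finally show "cov_fun M Z h = 1 / (2 * pi) ^ CARD('n) * (LINT \<omega>|lborel. cos (h \<bullet> \<omega>) * f \<omega>)" .
qed

lemma sphere_area_2: "sphere_area 2 = 2 * pi"
  using integral_angles_2[of "\<lambda>_. 1"] by (simp add: sphere_area_def vol_elem_def set_lebesgue_integral_def)

theorem lemma2p1:
  fixes M :: "'w measure"
    and Z :: "real ^ 'n::{finite,linorder} \<Rightarrow> 'w \<Rightarrow> real"
    and f :: "real ^ 'n::{finite,linorder} \<Rightarrow> real"
  assumes "CARD('n) \<ge> 2"
    and "prob_space M"
    and "zero_mean M Z"
    and "second_order_stationary M Z"
    and "spectral_density M Z f"
    and "\<And>\<omega>. f \<omega> \<ge> 0"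
  shows
    "(\<exists>g\<in>radial_profiles. radial_error f g = M_dist f) \<and>
     integrable lborel (\<lambda>\<omega>. (f \<omega>)\<^sup>2) \<and>
     set_integrable (angle_measure CARD('n)) (angles CARD('n)) (vol_elem CARD('n) 1) \<and>
     (\<forall>r\<ge>0. set_integrable (angle_measure CARD('n)) (angles CARD('n))
        (\<lambda>\<theta>. spherical_version f r \<theta> * vol_elem CARD('n) 1 \<theta>)) \<and>
     set_integrable lborel {0..} (\<lambda>r. (angular_integral f r)\<^sup>2 * r ^ (CARD('n) - 1)) \<and>
     enn2ereal (M_dist f) = ereal (D1 f - D2 f) \<and>
     (CARD('n) = 2 \<longrightarrow>
        (\<forall>r\<ge>0. integrable lborel (\<lambda>\<omega>. f \<omega> * bessel_J0 (r * norm \<omega>))) \<and>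
        set_integrable lborel {0..} (\<lambda>r. (LINT \<omega>|lborel. f \<omega> * bessel_J0 (r * norm \<omega>))\<^sup>2 * r) \<and>
        D2 f = 1 / (2 * pi) *
          (LINT r:{0..}|lborel. (LINT \<omega>|lborel. f \<omega> * bessel_J0 (r * norm \<omega>))\<^sup>2 * r))"
proof (intro conjI impI)
  let ?c = "cov_fun M Z"
  have d: "2 \<le> CARD('n)" by fact
  have c_int: "integrable lborel ?c" and f_int: "integrable lborel f"
    using assms(5) by (simp_all add: spectral_density_def)
  note f_eq = spectral_density_cos(1)[OF assms(5)] and c_eq = spectral_density_cos(2)[OF assms(5)]
  have f_meas [measurable]: "f \<in> borel_measurable borel"
    using borel_measurable_integrable[OF f_int] by simp
  define K where "K = (LINT h|lborel. \<bar>?c h\<bar>)"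
  have K: "\<bar>f \<omega>\<bar> \<le> K" for \<omega>
    unfolding f_eq K_def
  proof (rule integral_abs_bound_integral)
    show "integrable lborel (\<lambda>h. cos (\<omega> \<bullet> h) * ?c h)"
    proof (rule Bochner_Integration.integrable_bound[OF c_int])
      show "(\<lambda>h. cos (\<omega> \<bullet> h) * ?c h) \<in> borel_measurable lborel"
        using borel_measurable_integrable[OF c_int] by measurable
    qed (simp add: abs_mult mult_left_le_one_le)
  qed (use c_int in \<open>simp_all add: abs_mult mult_left_le_one_le\<close>)
  show f2: "integrable lborel (\<lambda>\<omega>. (f \<omega>)\<^sup>2)"
  proof (rule Bochner_Integration.integrable_bound)
    show "integrable lborel (\<lambda>\<omega>. K * f \<omega>)" using f_int by simp
    show "AE \<omega> in lborel. norm ((f \<omega>)\<^sup>2) \<le> norm (K * f \<omega>)"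
    proof (rule AE_I2)
      fix \<omega>
      have "\<bar>f \<omega>\<bar> * \<bar>f \<omega>\<bar> \<le> \<bar>K\<bar> * \<bar>f \<omega>\<bar>"
        using K[of \<omega>] by (intro mult_right_mono) auto
      then show "norm ((f \<omega>)\<^sup>2) \<le> norm (K * f \<omega>)"
        by (simp only: real_norm_def power2_eq_square abs_mult)
    qed
  qed measurable
  note proj = radial_projection[OF d f_meas K f2]
  show "\<exists>g\<in>radial_profiles. radial_error f g = M_dist f" by (rule proj(2))
  show "set_integrable (angle_measure CARD('n)) (angles CARD('n)) (vol_elem CARD('n) 1)"
    by (rule set_integrable_vol_elem)
  show "\<forall>r\<ge>0. set_integrable (angle_measure CARD('n)) (angles CARD('n))
        (\<lambda>\<theta>. spherical_version f r \<theta> * vol_elem CARD('n) 1 \<theta>)"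
    using set_integrable_spherical_version[OF d f_meas K] by blast
  show "set_integrable lborel {0..} (\<lambda>r. (angular_integral f r)\<^sup>2 * r ^ (CARD('n) - 1))"
    by (rule proj(1))
  show "enn2ereal (M_dist f) = ereal (D1 f - D2 f)" by (rule proj(3))
  show "\<forall>r\<ge>0. integrable lborel (\<lambda>\<omega>. f \<omega> * bessel_J0 (r * norm \<omega>))"
    using integrable_mult_bessel_J0[OF f_int] by blast
  assume 2: "CARD('n) = 2"
  \<comment> \<open>Rewriting the dimension turns \<open>(2 * pi) ^ CARD('n)\<close> into the
    \<open>(2 * pi)\<^sup>2\<close> expected by \<open>hankel_parseval\<close>.\<close>
  note hankel = hankel_parseval[OF 2 f_int c_int f_eq c_eq[unfolded 2]]
  show "set_integrable lborel {0..} (\<lambda>r. (LINT \<omega>|lborel. f \<omega> * bessel_J0 (r * norm \<omega>))\<^sup>2 * r)"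
    by (rule hankel(1))
  show "D2 f = 1 / (2 * pi) *
          (LINT r:{0..}|lborel. (LINT \<omega>|lborel. f \<omega> * bessel_J0 (r * norm \<omega>))\<^sup>2 * r)"
    \<comment> \<open>The normalizing area is 2 \<pi> and the radial weight is \<open>r ^ 1\<close>,
      so Parseval only has to exchange the squared angular integral for the squared Hankel
      transform.\<close>
    unfolding D2_def sphere_area_def[symmetric] 2 sphere_area_2 hankel(2)[symmetric] by simp
qed

end
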